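(* Let $\alpha\in(0,1)$. Assume that the heat kernel satisfies, for a constant $C>0$, $$p_s(x,y)\simeq\frac{1}{\mu(B(x,\sqrt s))}e^{-Cd(x,y)^2/s}\qquad\text{for all }(x,y,s)\in\mathbb M\times\mathbb M\times(0,\infty).$$ Let $1<p\le q<\infty$ and let $\nu\in\mathcal M_+(\mathbb M_+)$. Assume that the measure $\mu$ satisfies $$\inf_{(x,r)\in\mathbb M\times(0,\infty)}\frac{\mu(B(x,r))}{r^{\beta^\star}}>0 .$$ Then the extension $e^{-t\mathcal L^\alpha}:L^p(\mathbb M)\to L^q(\mathbb M_+,\nu)$ is bounded if and only if $$\sup_{\lambda\in(0,\infty)}\frac{\lambda^{p/q}}{\kappa(\nu;\lambda)}<\infty .$$ Furthermore, assume in addition that $\mu$ satisfies $$\sup_{(x,r)\in\mathbb M\times(0,\infty)}\frac{\mu(B(x,r))}{r^{\beta}}<\infty$$ and that $\beta=\beta^\star$. If $1<p<q<\infty$, then the condition $\lambda^{p/q}\lesssim\kappa(\nu;\lambda)$ for all $\lambda\in(0,\infty)$ can be (equivalently) replaced by $$\nu\big(B^{(\alpha)}_r(t_0,x_0)\big)\lesssim r^{q\beta/p}\qquad\text{for all }(r,t_0,x_0)\in(0,\infty)\times(0,\infty)\times\mathbb M\ \text{with } t_0\lesssim r^{2\alpha}.$$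
   Context: Setting: $(\mathbb M,d,\mu)$ is a metric measure space, i.e. $(\mathbb M,d)$ is a non-empty, locally compact, separable metric space and $\mu$ is a Borel measure on $\mathbb M$; $B(x,r)=\{y\in\mathbb M: d(x,y)<r\}$; $\mathbb M_+=\mathbb M\times(0,\infty)$, whose points are written $(t,x)$ with $t>0$, $x\in\mathbb M$. $\beta,\beta^\star$ are positive constants less than or equal to the Hausdorff dimension of $\mathbb M$. Heat kernel: a family $\{p_t\}_{t>0}$ of measurable functions on $\mathbb M\times\mathbb M$ such that for almost all $x,y\in\mathbb M$ and all $s,t>0$: (i) $p_t(x,y)\ge0$; (ii) $\int_{\mathbb M}p_t(x,y)\,d\mu(y)\le1$; (iii) $p_t(x,y)=p_t(y,x)$; (iv) $p_{s+t}(x,y)=\int_{\mathbb M}p_s(x,z)p_t(z,y)\,d\mu(z)$; (v) $\lim_{t\to0^+}\int_{\mathbb M}p_t(x,y)f(y)\,d\mu(y)=f(x)$ for all $f\in L^2(\mathbb M,\mu)$. It generates the semigroup $P_tf(x)=\int_{\mathbb M}p_t(x,y)f(y)\,d\mu(y)$ on $L^2(\mathbb M,\mu)$, with generator $\mathcal Lf=\lim_{t\to0}(f-P_tf)/t$ (limit in $L^2$), a self-adjoint, positive definite operator, so $P_t=e^{-t\mathcal L}$. Fractional heat semigroup: for $0<\alpha<1$, $e^{-t\mathcal L^\alpha}f(x)=\int_{\mathbb M}K^{\mathcal L}_{\alpha,t}(x,y)f(y)\,d\mu(y)$ with $K^{\mathcal L}_{\alpha,t}(x,y)=\int_0^\infty\eta^\alpha_t(s)p_s(x,y)\,ds$,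 where $\eta^\alpha_t$ is the non-negative continuous subordination density, satisfying $\eta^\alpha_t(s)=t^{-1/\alpha}\eta^\alpha_1(s/t^{1/\alpha})$; $\eta^\alpha_t(s)\lesssim t/s^{1+\alpha}$ for all $s,t>0$; $\int_0^\infty s^{-\gamma}\eta^\alpha_1(s)\,ds<\infty$ for $\gamma>0$; $\eta^\alpha_t(s)\simeq t/s^{1+\alpha}$ for $s\ge t^{1/\alpha}>0$. The extension maps $f$ on $\mathbb M$ to the function $(t,x)\mapsto e^{-t\mathcal L^\alpha}f(x)$ on $\mathbb M_+$. Capacity: for compact $K\subset\mathbb M_+$, $C^{(\alpha)}_p(K)=\inf\{\|f\|^p_{L^p(\mathbb M)}: f\ge0,\ e^{-t\mathcal L^\alpha}f(x)\ge1_K(t,x)\}$, where $1_K$ is the characteristic function of $K$. $\mathcal M_+(\mathbb M_+)$ is the class of all nonnegative Radon measures on $\mathbb M_+$, $L^q(\mathbb M_+,\nu)$ the Lebesgue space with respect to $\nu$, and for $\lambda>0$, $\kappa(\nu;\lambda)=\inf\{C^{(\alpha)}_p(K): K\subset\mathbb M_+\text{ compact},\ \nu(K)\ge\lambda\}$ (with $\inf\emptyset=+\infty$). Parabolic ball: $B^{(\alpha)}_r(t_0,x_0)=\{(t,x)\in\mathbb M_+: r^{2\alpha}<t-t_0<2r^{2\alpha},\ d(x,x_0)<r\}$. $X\lesssim Y$ means $X\le cY$ with a constant $c>0$ independent of the main parameters (variables such as $x,y,s,t,r,t_0,x_0,\lambda$); $X\simeq Y$ means $X\lesssim Y\lesssim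 X$. In particular $t_0\lesssim r^{2\alpha}$ means $t_0\le c\,r^{2\alpha}$ for a fixed constant $c>0$. *)

theory Defs
  imports "HOL-Analysis.Analysis"
begin

text \<open>
  The space is a type of class \<open>metric_space\<close>; for metric spaces, separability
  is the class \<open>second_countable_topology\<close>.
\<close>

definition metric_measure_space ::
    "'a::{metric_space,second_countable_topology} measure \<Rightarrow> bool" where
  "metric_measure_space \<mu> \<longleftrightarrow> locally compact (UNIV :: 'a set) \<and> sets \<mu> = sets borel"

definition hausdorff_content :: "real \<Rightarrow> real \<Rightarrow> 'a::metric_space set \<Rightarrow> ennreal" where
  "hausdorff_content \<delta> s A =
     (INF U\<in>{U :: nat \<Rightarrow> 'a set. A \<subseteq> (\<Union>i. U i) \<and> (\<forall>i. bounded (U i) \<and> diameter (U i) \<le> \<delta>)}.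
        \<Sum>i. ennreal (diameter (U i) powr s))"

definition hausdorff_measure :: "real \<Rightarrow> 'a::metric_space set \<Rightarrow> ennreal" where
  "hausdorff_measure s A = (SUP \<delta>\<in>{0<..}. hausdorff_content \<delta> s A)"

text \<open>
  Only \<open>s > 0\<close> is used, which does not change the infimum and avoids the convention
  \<open>0 powr 0 = 0\<close>. The dimension is \<open>\<infinity>\<close> if no Hausdorff measure vanishes.
\<close>

definition hausdorff_dim :: "'a::metric_space set \<Rightarrow> ennreal" where
  "hausdorff_dim A = Inf {ennreal s | s. s > 0 \<and> hausdorff_measure s A = 0}"

definition Lp_space :: "'b measure \<Rightarrow> real \<Rightarrow> ('b \<Rightarrow> real) set" where
  "Lp_space M p =
     {f \<in> borel_measurable M. (\<integral>\<^sup>+ x. ennreal (\<bar>f x\<bar> powr p) \<partial>M) < \<infinity>}"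

definition Lp_norm :: "'b measure \<Rightarrow> real \<Rightarrow> ('b \<Rightarrow> real) \<Rightarrow> real" where
  "Lp_norm M p f = enn2real (\<integral>\<^sup>+ x. ennreal (\<bar>f x\<bar> powr p) \<partial>M) powr (1 / p)"

definition Lp_Lq_bounded ::
    "'b measure \<Rightarrow> real \<Rightarrow> 'c measure \<Rightarrow> real \<Rightarrow> (('b \<Rightarrow> real) \<Rightarrow> 'c \<Rightarrow> real) \<Rightarrow> bool" where
  "Lp_Lq_bounded M p N q T \<longleftrightarrow>
     (\<exists>A\<ge>0. \<forall>f\<in>Lp_space M p. T f \<in> Lp_space N q \<and> Lp_norm N q (T f) \<le> A * Lp_norm M p f)"

text \<open>
  Measurability is joint in time and space, so that the time integral in
  \<open>frac_kernel\<close> and the resulting extension are measurable. ``For almost all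
  \<open>x\<close>, \<open>y\<close>'' is an iterated quantifier, which needs no \<open>\<sigma>\<close>-finiteness of \<open>\<mu>\<close>.
  The integrals of the non-negative functions in the sub-Markov and semigroup properties
  are \<open>[0,\<infinity>]\<close>-valued, so that no integrability has to be presupposed.
  In the approximation property the exceptional set may depend on \<open>f\<close>.
\<close>

definition heat_kernel ::
    "'a::{metric_space,second_countable_topology} measure \<Rightarrow> (real \<Rightarrow> 'a \<Rightarrow> 'a \<Rightarrow> real) \<Rightarrow> bool" where
  "heat_kernel \<mu> h \<longleftrightarrow>
     (\<lambda>(t, x, y). h t x y) \<in> borel_measurable (restrict_space borel {0<..} \<Otimes>\<^sub>M (\<mu> \<Otimes>\<^sub>M \<mu>)) \<and>
     (AE x in \<mu>. AE y in \<mu>. \<forall>s>0. \<forall>t>0.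
        0 \<le> h t x y \<and>
        (\<integral>\<^sup>+ z. ennreal (h t x z) \<partial>\<mu>) \<le> 1 \<and>
        h t x y = h t y x \<and>
        ennreal (h (s + t) x y) = (\<integral>\<^sup>+ z. ennreal (h s x z * h t z y) \<partial>\<mu>)) \<and>
     (\<forall>f\<in>Lp_space \<mu> 2. AE x in \<mu>.
        ((\<lambda>t. \<integral>y. h t x y * f y \<partial>\<mu>) \<longlongrightarrow> f x) (at_right 0))"

text \<open>
  If \<open>\<mu>\<close> is infinite on a ball, \<open>measure\<close> and hence the reciprocal below is \<open>0\<close>,
  in agreement with \<open>1 / \<infinity> = 0\<close>.
\<close>

definition gaussian_bounds ::
    "'a::metric_space measure \<Rightarrow> (real \<Rightarrow> 'a \<Rightarrow> 'a \<Rightarrow> real) \<Rightarrow> real \<Rightarrow> bool" where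
  "gaussian_bounds \<mu> h C \<longleftrightarrow>
     (\<exists>c\<^sub>1>0. \<exists>c\<^sub>2>0. \<forall>x y. \<forall>s>0.
        c\<^sub>1 * (1 / measure \<mu> (ball x (sqrt s)) * exp (- C * (dist x y)\<^sup>2 / s)) \<le> h s x y \<and>
        h s x y \<le> c\<^sub>2 * (1 / measure \<mu> (ball x (sqrt s)) * exp (- C * (dist x y)\<^sup>2 / s)))"

text \<open>
  The family \<open>\<eta> t\<close> (\<open>t > 0\<close>) of densities on \<open>(0, \<infinity>)\<close> of the \<open>\<alpha>\<close>-stable subordinator.
  Continuity and the Laplace transform, which encodes the subordination formula
  \<open>exp (- t l\<^sup>\<alpha>) = \<integral> exp (- s l) \<eta>\<^sub>t(s) ds\<close>, already determine it;
  the remaining conjuncts are its standard scaling, size and moment properties.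
\<close>

definition subordination_density :: "real \<Rightarrow> (real \<Rightarrow> real \<Rightarrow> real) \<Rightarrow> bool" where
  "subordination_density \<alpha> \<eta> \<longleftrightarrow>
     (\<forall>t>0. continuous_on {0<..} (\<eta> t)) \<and>
     (\<forall>t>0. \<forall>s>0. 0 \<le> \<eta> t s) \<and>
     (\<forall>t>0. \<forall>l\<ge>0. (\<integral>\<^sup>+ s\<in>{0<..}. ennreal (exp (- s * l) * \<eta> t s) \<partial>lborel)
                     = ennreal (exp (- t * l powr \<alpha>))) \<and>
     (\<forall>t>0. \<forall>s>0. \<eta> t s = t powr (- 1 / \<alpha>) * \<eta> 1 (s / t powr (1 / \<alpha>))) \<and>
     (\<exists>c>0. \<forall>t>0. \<forall>s>0. \<eta> t s \<le> c * (t / s powr (1 + \<alpha>))) \<and>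
     (\<forall>\<gamma>>0. (\<integral>\<^sup>+ s\<in>{0<..}. ennreal (s powr (- \<gamma>) * \<eta> 1 s) \<partial>lborel) < \<infinity>) \<and>
     (\<exists>c\<^sub>1>0. \<exists>c\<^sub>2>0. \<forall>t>0. \<forall>s\<ge>t powr (1 / \<alpha>).
        c\<^sub>1 * (t / s powr (1 + \<alpha>)) \<le> \<eta> t s \<and> \<eta> t s \<le> c\<^sub>2 * (t / s powr (1 + \<alpha>)))"

definition frac_kernel ::
    "(real \<Rightarrow> real \<Rightarrow> real) \<Rightarrow> (real \<Rightarrow> 'a \<Rightarrow> 'a \<Rightarrow> real) \<Rightarrow> real \<Rightarrow> 'a \<Rightarrow> 'a \<Rightarrow> real" where
  "frac_kernel \<eta> h t x y = (LINT s:{0<..}|lborel. \<eta> t s * h s x y)"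

definition frac_extension ::
    "'a measure \<Rightarrow> (real \<Rightarrow> real \<Rightarrow> real) \<Rightarrow> (real \<Rightarrow> 'a \<Rightarrow> 'a \<Rightarrow> real) \<Rightarrow>
     ('a \<Rightarrow> real) \<Rightarrow> real \<times> 'a \<Rightarrow> real" where
  "frac_extension \<mu> \<eta> h f = (\<lambda>(t, x). \<integral>y. frac_kernel \<eta> h t x y * f y \<partial>\<mu>)"

definition upper_half :: "(real \<times> 'a) set" where
  "upper_half = {0<..} \<times> UNIV"

definition radon_measure_on :: "'b::topological_space set \<Rightarrow> 'b measure \<Rightarrow> bool" where
  "radon_measure_on S \<nu> \<longleftrightarrow>
     sets \<nu> = sets (restrict_space borel S) \<and>
     (\<forall>K. compact K \<and> K \<subseteq> S \<longrightarrow> emeasure \<nu> K < \<infinity>) \<and>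
     (\<forall>A\<in>sets \<nu>. emeasure \<nu> A = (SUP K\<in>{K. compact K \<and> K \<subseteq> A}. emeasure \<nu> K))"

definition frac_capacity ::
    "'a measure \<Rightarrow> (real \<Rightarrow> real \<Rightarrow> real) \<Rightarrow> (real \<Rightarrow> 'a \<Rightarrow> 'a \<Rightarrow> real) \<Rightarrow> real \<Rightarrow>
     (real \<times> 'a) set \<Rightarrow> ennreal" where
  "frac_capacity \<mu> \<eta> h p K =
     (INF f\<in>{f \<in> Lp_space \<mu> p. (\<forall>x. 0 \<le> f x) \<and>
              (\<forall>z\<in>upper_half. frac_extension \<mu> \<eta> h f z \<ge> indicat_real K z)}.
        ennreal (Lp_norm \<mu> p f powr p))"

definition capacity_minimizing ::
    "'a::metric_space measure \<Rightarrow> (real \<Rightarrow> real \<Rightarrow> real) \<Rightarrow> (real \<Rightarrow> 'a \<Rightarrow> 'a \<Rightarrow> real) \<Rightarrow> real \<Rightarrow>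
     (real \<times> 'a) measure \<Rightarrow> real \<Rightarrow> ennreal" where
  "capacity_minimizing \<mu> \<eta> h p \<nu> l =
     (INF K\<in>{K. compact K \<and> K \<subseteq> upper_half \<and> emeasure \<nu> K \<ge> ennreal l}.
        frac_capacity \<mu> \<eta> h p K)"

definition parabolic_ball ::
    "real \<Rightarrow> real \<Rightarrow> real \<Rightarrow> 'a::metric_space \<Rightarrow> (real \<times> 'a) set" where
  "parabolic_ball \<alpha> r t\<^sub>0 x\<^sub>0 =
     {(t, x) \<in> upper_half. r powr (2 * \<alpha>) < t - t\<^sub>0 \<and> t - t\<^sub>0 < 2 * r powr (2 * \<alpha>) \<and> dist x x\<^sub>0 < r}"

end

theory Submission
  imports Defs
begin

text \<open>
  The extension is an approximate identity. With \<open>rad t = t\<^bsup>1 / (2 \<alpha>)\<^esup>\<close>, its kernel at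
  \<open>(t, x)\<close> is comparable to \<open>1 / \<mu>(B(x, rad t))\<close> on the ball \<open>B(x, rad t)\<close>, and the extension
  of \<open>f\<close> at \<open>(t, x)\<close> is at most a constant times the Hardy-Littlewood maximal function of \<open>f\<close> at
  every point of that ball. The criteria are therefore Carleson embedding theorems.
  Everything is expressed through the shadow of a compact set
  \<open>K\<close>, the union of the balls \<open>B(x, rad t)\<close> over \<open>(t, x)\<close> in \<open>K\<close>.

  The maximal theorem needs a doubling measure. Doubling is a consequence of the two-sided
  Gaussian bound and the fact that the heat kernel has mass at most one
  (\<open>heat_kernel_doubling\<close>). If balls have infinite measure, the extension vanishes. The upper
  estimate (\<open>frac_extension_level_in_maximal_set\<close>) splits the Gaussian into dyadic balls; the
  loss incurred at times \<open>s\<close> below \<open>(rad t)\<^sup>2\<close> is a power of \<open>rad t / \<surd>s\<close>, which the negative moments of the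
  subordination density absorb. The lower estimate (\<open>frac_extension_indicator_lower\<close>) uses
  the part of the subordination integral where \<open>s\<close> is comparable to \<open>(rad t)\<^sup>2\<close>.

  The lower estimate makes a multiple of the indicator of the shadow of \<open>K\<close> admissible, so
  the capacity of \<open>K\<close> is at most a multiple of \<open>\<mu>(shadow K)\<close>, and the capacity condition
  implies \<open>\<nu>(K) \<le> A \<mu>(shadow K)\<^bsup>q / p\<^esup>\<close>. By the upper estimate, the shadow of a compact subset
  of \<open>{\<bar>T f\<bar> > 2\<^sup>k}\<close> lies in a level set of the maximal function. Hence this shadow condition, inner
  regularity of \<open>\<nu>\<close> and the strong maximal inequality in dyadic form give boundedness
  (\<open>bounded_if_shadow_condition\<close>); this takes the place of a capacitary strong type
  inequality. The converse is the definition of the capacity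
  (\<open>capacity_condition_if_bounded\<close>).

  For the parabolic balls, testing on the indicator of a ball gives necessity. For
  sufficiency, \<open>K\<close> is cut into layers of times comparable to \<open>r\<^bsup>2 \<alpha>\<^esup>\<close>. A layer is covered by
  at most a multiple of \<open>\<mu>(shadow K) r\<^bsup>-\<beta>\<^esup>\<close> parabolic balls of measure at most a multiple
  of \<open>r\<^bsup>q \<beta> / p\<^esup>\<close>. For \<open>p < q\<close> the sum over the scales is dominated by the largest one, which
  satisfies \<open>r\<^bsup>\<beta>\<^esup> \<le> A' \<mu>(shadow K)\<close>, and the shadow condition follows
  (\<open>shadow_condition_if_ball_condition\<close>).
\<close>

section \<open>Dyadic sums over the integers\<close>

lemma dyadic_sum_below:
  fixes a v :: real
  assumes "0 < a" "0 < v"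
  shows "(\<integral>\<^sup>+k. ennreal (2 powr (real_of_int k * a)) * indicator {k. 2 powr real_of_int k < v} k \<partial>count_space UNIV)
    \<le> ennreal (v powr a / (1 - 2 powr (-a)))"
proof -
  let ?f = "\<lambda>k::int. ennreal (2 powr (k * a))"
  define m :: int where "m = \<lceil>log 2 v\<rceil> - 1"
  have m: "2 powr real_of_int m \<le> v"
  proof -
    have "real_of_int m \<le> log 2 v" unfolding m_def by linarith
    then show ?thesis using assms(2) by (simp add: le_log_iff)
  qed
  have sub: "{k::int. 2 powr k < v} \<subseteq> {..m}"
  proof
    fix k :: int assume "k \<in> {k. 2 powr k < v}"
    then have "real_of_int k < log 2 v" using assms(2) by (simp add: less_log_iff)
    then show "k \<in> {..m}" unfolding m_def by (simp add: less_ceiling_iff)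
  qed
  have bij: "bij_betw (\<lambda>j::nat. m - int j) UNIV {..m}"
    by (rule bij_betwI[where g = "\<lambda>k. nat (m - k)"]) auto
  have r: "0 < 2 powr (-a)" "2 powr (-a) < 1"
    using assms(1) by (simp_all add: powr_less_one)
  have "(\<integral>\<^sup>+k. ?f k * indicator {k. 2 powr real_of_int k < v} k \<partial>count_space UNIV)
      \<le> (\<integral>\<^sup>+k. ?f k * indicator {..m} k \<partial>count_space UNIV)"
    using sub by (intro nn_integral_mono) (auto split: split_indicator)
  also have "\<dots> = (\<integral>\<^sup>+k. ?f k \<partial>count_space {..m})"
    by (simp add: nn_integral_count_space_indicator)
  also have "\<dots> = (\<integral>\<^sup>+j. ?f (m - int j) \<partial>count_space UNIV)"
    by (rule nn_integral_bij_count_space[OF bij, symmetric])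
  also have "\<dots> = (\<Sum>j. ?f (m - int j))"
    by (rule nn_integral_count_space_nat)
  also have "\<dots> = (\<Sum>j. ennreal ((2 powr m) powr a * (2 powr (-a)) ^ j))"
    by (intro suminf_cong arg_cong[where f = ennreal])
       (simp add: powr_realpow[symmetric] powr_powr powr_add[symmetric] algebra_simps)
  also have "\<dots> = ennreal (\<Sum>j. (2 powr m) powr a * (2 powr (-a)) ^ j)"
    using r by (intro suminf_ennreal2 summable_mult summable_geometric) auto
  also have "(\<Sum>j. (2 powr m) powr a * (2 powr (-a)) ^ j) = (2 powr m) powr a / (1 - 2 powr (-a))"
    using r by (subst suminf_mult) (auto simp: suminf_geometric summable_geometric)
  also have "ennreal \<dots> \<le> ennreal (v powr a / (1 - 2 powr (-a)))"
    using r m assms(1) by (intro ennreal_leI divide_right_mono powr_mono2) auto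
  finally show ?thesis .
qed

lemma powr_le_dyadic_sum:
  fixes q v :: real
  assumes "0 < q" "0 \<le> v"
  shows "ennreal (v powr q)
    \<le> (\<integral>\<^sup>+k. ennreal (2 powr ((real_of_int k + 1) * q)) * indicator {k. 2 powr real_of_int k < v} k \<partial>count_space UNIV)"
proof (cases "v = 0")
  case False
  then have v: "0 < v" using assms by simp
  define k :: int where "k = \<lceil>log 2 v\<rceil> - 1"
  have "real_of_int k < log 2 v" "log 2 v \<le> real_of_int k + 1" unfolding k_def by linarith+
  then have k: "2 powr k < v" "v \<le> 2 powr (k + 1)"
    using v by (simp_all add: less_log_iff log_le_iff)
  have "ennreal (v powr q) \<le> ennreal (2 powr ((real_of_int k + 1) * q))"
    using k(2) assms v by (intro ennreal_leI) (simp add: powr_powr[symmetric] powr_mono2)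
  also have "\<dots> = ennreal (2 powr ((real_of_int k + 1) * q)) * indicator {k. 2 powr real_of_int k < v} k"
    using k(1) by simp
  also have "\<dots> \<le> (\<integral>\<^sup>+k. ennreal (2 powr ((real_of_int k + 1) * q)) * indicator {k. 2 powr real_of_int k < v} k \<partial>count_space UNIV)"
    by (rule nn_integral_ge_point) simp
  finally show ?thesis .
qed simp

text \<open>The embedding of \<open>\<ell>\<^sup>1\<close> into \<open>\<ell>\<^sup>r\<close>; it is what raises the exponent from \<open>p\<close> to \<open>q\<close>.\<close>

lemma sum_powr_le_powr_sum:
  fixes m :: "'i \<Rightarrow> real"
  assumes "1 \<le> r" "0 \<le> S" and m: "\<And>k. 0 \<le> m k"
    and S: "(\<integral>\<^sup>+k. ennreal (m k) \<partial>count_space UNIV) \<le> ennreal S"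
  shows "(\<integral>\<^sup>+k. ennreal (m k powr r) \<partial>count_space UNIV) \<le> ennreal (S powr r)"
proof -
  have le: "m k \<le> S" for k
  proof -
    have "ennreal (m k) \<le> ennreal S"
      using nn_integral_ge_point[of k UNIV "\<lambda>k. ennreal (m k)"] S by (simp add: order_trans)
    then show ?thesis using assms(2) by simp
  qed
  have "m k powr r \<le> S powr (r - 1) * m k" for k
  proof (cases "m k = 0")
    case False
    then have "m k powr r = m k powr (r - 1) * m k"
      using m[of k] by (simp add: powr_diff)
    also have "\<dots> \<le> S powr (r - 1) * m k"
      using le m assms(1) by (intro mult_right_mono powr_mono2) auto
    finally show ?thesis .
  qed simp
  then have "(\<integral>\<^sup>+k. ennreal (m k powr r) \<partial>count_space UNIV)
      \<le> (\<integral>\<^sup>+k. ennreal (S powr (r - 1)) * ennreal (m k) \<partial>count_space UNIV)"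
    using m by (intro nn_integral_mono) (simp add: ennreal_mult[symmetric] ennreal_leI)
  also have "\<dots> = ennreal (S powr (r - 1)) * (\<integral>\<^sup>+k. ennreal (m k) \<partial>count_space UNIV)"
    by (rule nn_integral_cmult) simp
  also have "\<dots> \<le> ennreal (S powr (r - 1)) * ennreal S"
    by (rule mult_left_mono[OF S]) simp
  also have "\<dots> = ennreal (S powr r)"
    using assms(1,2) by (cases "S = 0") (simp_all add: ennreal_mult[symmetric] powr_diff)
  finally show ?thesis .
qed

section \<open>Maximal sets in doubling metric measure spaces\<close>

text \<open>
  Choosing greedily the ball of largest radius: a ball that meets a chosen ball of at least
  its own radius lies in the threefold enlargement of the latter.
\<close>

lemma finite_vitali_covering:
  fixes x :: "'i \<Rightarrow> 'a::metric_space" and r :: "'i \<Rightarrow> real"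
  assumes "finite I" "\<And>i. i \<in> I \<Longrightarrow> 0 < r i"
  shows "\<exists>J\<subseteq>I. disjoint_family_on (\<lambda>i. ball (x i) (r i)) J \<and>
    (\<Union>i\<in>I. ball (x i) (r i)) \<subseteq> (\<Union>i\<in>J. ball (x i) (3 * r i))"
  using assms
proof (induction I rule: finite_psubset_induct)
  case (psubset I)
  show ?case
  proof (cases "I = {}")
    case False
    obtain i where i: "i \<in> I" "\<And>j. j \<in> I \<Longrightarrow> r j \<le> r i"
    proof -
      have "Max (r ` I) \<in> r ` I" using psubset(1) False by (intro Max_in) auto
      then obtain i where "i \<in> I" "r i = Max (r ` I)" by auto
      then show ?thesis using that[of i] psubset(1) by simp
    qed
    define I' where "I' = {j \<in> I. ball (x j) (r j) \<inter> ball (x i) (r i) = {}}"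
    have "i \<notin> I'" using psubset.prems[OF i(1)] by (simp add: I'_def)
    then have "I' \<subset> I" using i(1) unfolding I'_def by blast
    then obtain J where J: "J \<subseteq> I'" "disjoint_family_on (\<lambda>i. ball (x i) (r i)) J"
      "(\<Union>i\<in>I'. ball (x i) (r i)) \<subseteq> (\<Union>i\<in>J. ball (x i) (3 * r i))"
      using psubset.IH[of I'] psubset.prems by blast
    have "disjoint_family_on (\<lambda>i. ball (x i) (r i)) (insert i J)"
      using J(1,2) unfolding disjoint_family_on_def I'_def by blast
    moreover have "ball (x j) (r j) \<subseteq> (\<Union>i\<in>insert i J. ball (x i) (3 * r i))" if j: "j \<in> I" for j
    proof (cases "j \<in> I'")
      case True
      then show ?thesis using J(3) by blast
    next
      case False
      then obtain z where z: "dist (x j) z < r j" "dist (x i) z < r i"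
        using j unfolding I'_def by auto
      have "ball (x j) (r j) \<subseteq> ball (x i) (3 * r i)"
      proof
        fix y assume "y \<in> ball (x j) (r j)"
        then have "dist (x j) y < r j" by simp
        then have "dist (x i) y < r i + r j + r j"
          using z dist_triangle[of "x i" y z] dist_triangle[of z y "x j"]
          by (simp add: dist_commute)
        then show "y \<in> ball (x i) (3 * r i)" using i(2)[OF j] by simp
      qed
      then show ?thesis by blast
    qed
    ultimately show ?thesis using J(1) i(1) \<open>I' \<subset> I\<close>
      by (intro exI[of _ "insert i J"]) (auto simp: I'_def)
  qed (simp add: disjoint_family_on_def)
qed

locale doubling_space =
  fixes \<mu> :: "'a::{metric_space,second_countable_topology} measure" and D :: real
  assumes sets_borel: "sets \<mu> = sets borel"
    and ball_finite: "emeasure \<mu> (ball x r) < \<infinity>"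
    and ball_pos: "0 < r \<Longrightarrow> 0 < emeasure \<mu> (ball x r)"
    and D_ge: "2 \<le> D"
    and doubling: "0 < r \<Longrightarrow> emeasure \<mu> (ball x (2 * r)) \<le> ennreal D * emeasure \<mu> (ball x r)"
begin

lemma space_UNIV: "space \<mu> = UNIV"
  using sets_eq_imp_space_eq[OF sets_borel] by simp

lemma ball_sets [measurable]: "ball x r \<in> sets \<mu>"
  by (simp add: sets_borel)

lemma open_sets: "open S \<Longrightarrow> S \<in> sets \<mu>"
  by (simp add: sets_borel)

definition vol :: "'a \<Rightarrow> real \<Rightarrow> real" where
  "vol x r = measure \<mu> (ball x r)"

lemma emeasure_ball: "emeasure \<mu> (ball x r) = ennreal (vol x r)"
  unfolding vol_def using ball_finite[of x r] by (simp add: emeasure_eq_ennreal_measure)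

lemma vol_nonneg: "0 \<le> vol x r"
  by (simp add: vol_def)

lemma vol_pos: "0 < r \<Longrightarrow> 0 < vol x r"
  using ball_pos[of r x] by (simp add: emeasure_ball)

lemma emeasure_bounded_finite: "bounded S \<Longrightarrow> emeasure \<mu> S < \<infinity>"
proof -
  assume "bounded S"
  then obtain x r where "S \<subseteq> ball x r" by (meson bounded_subset_ballD)
  then show ?thesis using emeasure_mono[of S "ball x r" \<mu>] ball_finite[of x r] by (simp add: le_less_trans)
qed

lemma vol_mono: "ball x r \<subseteq> ball y s \<Longrightarrow> vol x r \<le> vol y s"
  using emeasure_mono[of "ball x r" "ball y s" \<mu>] by (simp add: emeasure_ball vol_nonneg)

lemma vol_mono_radius: "r \<le> s \<Longrightarrow> vol x r \<le> vol x s"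
  by (rule vol_mono) auto

lemma vol_double: "0 < r \<Longrightarrow> vol x (2 * r) \<le> D * vol x r"
  using doubling[of r x] D_ge vol_nonneg[of x r]
  by (simp add: emeasure_ball ennreal_mult[symmetric])

lemma vol_double_iterated: "0 < r \<Longrightarrow> vol x (2 ^ k * r) \<le> D ^ k * vol x r"
proof (induction k)
  case (Suc k)
  have "vol x (2 ^ Suc k * r) = vol x (2 * (2 ^ k * r))" by (simp add: mult_ac)
  also have "\<dots> \<le> D * vol x (2 ^ k * r)" using Suc by (intro vol_double) simp
  also have "\<dots> \<le> D * (D ^ k * vol x r)" using Suc D_ge by (intro mult_left_mono) auto
  finally show ?case by (simp add: mult_ac)
qed simp

definition growth :: real where "growth = log 2 D"

lemma growth_pos: "0 < growth"
  unfolding growth_def using D_ge by simp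

text \<open>Iterated doubling gives volume growth of order at most \<open>growth = log\<^sub>2 D\<close>.\<close>

lemma vol_growth:
  assumes "0 < r" "r \<le> R"
  shows "vol x R \<le> D * (R / r) powr growth * vol x r"
proof -
  define k where "k = nat \<lceil>log 2 (R / r)\<rceil>"
  have Rr: "1 \<le> R / r" using assms by simp
  then have l: "0 \<le> log 2 (R / r)" using assms by simp
  then have k: "log 2 (R / r) \<le> real k" "real k \<le> log 2 (R / r) + 1"
    unfolding k_def by linarith+
  have "R / r \<le> 2 powr real k" using k(1) Rr by (subst (asm) log_le_iff) auto
  then have "R \<le> 2 ^ k * r" using assms by (simp add: powr_realpow field_simps)
  then have "vol x R \<le> vol x (2 ^ k * r)" by (rule vol_mono_radius)
  also have "\<dots> \<le> D ^ k * vol x r" by (rule vol_double_iterated[OF assms(1)])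
  also have "D ^ k \<le> D * (R / r) powr growth"
  proof -
    have "D ^ k = D powr real k" using D_ge by (simp add: powr_realpow)
    also have "\<dots> \<le> D powr (log 2 (R / r) + 1)" using k(2) D_ge by (intro powr_mono) auto
    also have "\<dots> = D * D powr (log 2 (R / r))" using D_ge by (simp add: powr_add)
    also have "D powr (log 2 (R / r)) = (R / r) powr growth"
      using D_ge Rr assms unfolding growth_def powr_def log_def by (simp add: divide_simps)
    finally show ?thesis .
  qed
  finally show ?thesis using vol_nonneg by (simp add: mult_right_mono)
qed

lemma sigma_finite: "sigma_finite_measure \<mu>"
proof
  let ?A = "range (\<lambda>n::nat. ball (undefined::'a) (real n))"
  have "\<Union>?A = UNIV"
  proof -
    have "\<exists>n::nat. dist undefined y < real n" for y :: 'a by (rule reals_Archimedean2)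
    then show ?thesis by auto
  qed
  then show "\<exists>A. countable A \<and> A \<subseteq> sets \<mu> \<and> \<Union>A = space \<mu> \<and> (\<forall>a\<in>A. emeasure \<mu> a \<noteq> \<infinity>)"
    using ball_finite by (intro exI[of _ ?A]) (auto simp: space_UNIV less_top[symmetric])
qed

text \<open>
  The set where the uncentred Hardy-Littlewood maximal function of \<open>F\<close> exceeds \<open>l\<close>,
  written without quotients.
\<close>

definition maximal_set :: "('a \<Rightarrow> ennreal) \<Rightarrow> real \<Rightarrow> 'a set" where
  "maximal_set F l = \<Union>{ball x r |x r. 0 < r \<and>
     ennreal l * emeasure \<mu> (ball x r) < (\<integral>\<^sup>+z. F z * indicator (ball x r) z \<partial>\<mu>)}"

lemma open_maximal_set: "open (maximal_set F l)"
  unfolding maximal_set_def by (intro open_Union) auto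

lemma average_le_outside_maximal_set:
  assumes "y \<notin> maximal_set F l" "y \<in> ball x r"
  shows "(\<integral>\<^sup>+z. F z * indicator (ball x r) z \<partial>\<mu>) \<le> ennreal l * emeasure \<mu> (ball x r)"
proof (rule ccontr)
  assume "\<not> ?thesis"
  moreover have "0 < r" using assms(2) by (metis mem_ball dist_not_less_zero le_less_trans not_le)
  ultimately have "ball x r \<subseteq> maximal_set F l" unfolding maximal_set_def
    by (intro Union_upper CollectI exI[of _ x] exI[of _ r]) (simp add: not_le)
  with assms show False by blast
qed

text \<open>
  By Lindelof it suffices to estimate finite unions of the balls defining the maximal set,
  and by the covering lemma such a union is controlled by a disjoint subfamily.
\<close>

lemma maximal_set_weak_type:
  assumes [measurable]: "F \<in> borel_measurable \<mu>" and "0 < l"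
  shows "ennreal l * emeasure \<mu> (maximal_set F l) \<le> ennreal (D\<^sup>2) * (\<integral>\<^sup>+z. F z \<partial>\<mu>)"
proof -
  let ?B = "{ball x r |x r. 0 < r \<and>
     ennreal l * emeasure \<mu> (ball x r) < (\<integral>\<^sup>+z. F z * indicator (ball x r) z \<partial>\<mu>)}"
  obtain B where B: "B \<subseteq> ?B" "countable B" "\<Union>B = maximal_set F l"
    unfolding maximal_set_def using Lindelof[of ?B] by auto
  show ?thesis
  proof (cases "B = {}")
    case True
    then show ?thesis using B(3) by auto
  next
    case False
    let ?b = "from_nat_into B"
    have "?b n \<in> ?B" for n using B(1) from_nat_into[OF False, of n] by auto
    then have "\<forall>n. \<exists>x r. ?b n = ball x r \<and> 0 < r \<and>
        ennreal l * emeasure \<mu> (ball x r) < (\<integral>\<^sup>+z. F z * indicator (ball x r) z \<partial>\<mu>)" by auto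
    then obtain x r where xr: "\<And>n. ?b n = ball (x n) (r n)" "\<And>n. 0 < r n"
      "\<And>n. ennreal l * emeasure \<mu> (ball (x n) (r n)) < (\<integral>\<^sup>+z. F z * indicator (ball (x n) (r n)) z \<partial>\<mu>)"
      by metis
    have U: "maximal_set F l = (\<Union>n. \<Union>i\<in>{..n}. ball (x i) (r i))"
    proof -
      have "maximal_set F l = (\<Union>n. ?b n)" using B(3) range_from_nat_into[OF False B(2)] by simp
      also have "\<dots> = (\<Union>n. \<Union>i\<in>{..n}. ?b i)" by auto
      finally show ?thesis by (simp only: xr(1))
    qed
    have fin: "ennreal l * emeasure \<mu> (\<Union>i\<in>{..n}. ball (x i) (r i)) \<le> ennreal (D\<^sup>2) * (\<integral>\<^sup>+z. F z \<partial>\<mu>)" for n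
    proof -
      obtain J where J: "J \<subseteq> {..n}" "disjoint_family_on (\<lambda>i. ball (x i) (r i)) J"
        "(\<Union>i\<in>{..n}. ball (x i) (r i)) \<subseteq> (\<Union>i\<in>J. ball (x i) (3 * r i))"
        using finite_vitali_covering[of "{..n}" r x] xr(2) by auto
      then have [simp]: "finite J" using finite_subset by blast
      have "emeasure \<mu> (\<Union>i\<in>{..n}. ball (x i) (r i)) \<le> emeasure \<mu> (\<Union>i\<in>J. ball (x i) (3 * r i))"
        by (intro emeasure_mono J(3)) auto
      also have "\<dots> \<le> (\<Sum>i\<in>J. emeasure \<mu> (ball (x i) (3 * r i)))"
        by (intro emeasure_subadditive_finite) auto
      also have "\<dots> \<le> (\<Sum>i\<in>J. ennreal (D\<^sup>2) * emeasure \<mu> (ball (x i) (r i)))"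
      proof (intro sum_mono)
        fix i
        have "vol (x i) (3 * r i) \<le> vol (x i) (2 ^ 2 * r i)"
          using xr(2)[of i] by (intro vol_mono_radius) simp
        also have "\<dots> \<le> D\<^sup>2 * vol (x i) (r i)" by (rule vol_double_iterated[OF xr(2)])
        finally show "emeasure \<mu> (ball (x i) (3 * r i)) \<le> ennreal (D\<^sup>2) * emeasure \<mu> (ball (x i) (r i))"
          by (simp add: emeasure_ball ennreal_mult[symmetric] vol_nonneg)
      qed
      finally have "ennreal l * emeasure \<mu> (\<Union>i\<in>{..n}. ball (x i) (r i))
          \<le> ennreal l * (\<Sum>i\<in>J. ennreal (D\<^sup>2) * emeasure \<mu> (ball (x i) (r i)))"
        by (rule mult_left_mono) simp
      also have "\<dots> = ennreal (D\<^sup>2) * (\<Sum>i\<in>J. ennreal l * emeasure \<mu> (ball (x i) (r i)))"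
        by (simp add: sum_distrib_left mult_ac)
      also have "\<dots> \<le> ennreal (D\<^sup>2) * (\<Sum>i\<in>J. \<integral>\<^sup>+z. F z * indicator (ball (x i) (r i)) z \<partial>\<mu>)"
        using xr(3) by (intro mult_left_mono sum_mono) (auto intro: less_imp_le)
      also have "(\<Sum>i\<in>J. \<integral>\<^sup>+z. F z * indicator (ball (x i) (r i)) z \<partial>\<mu>)
          = (\<integral>\<^sup>+z. (\<Sum>i\<in>J. F z * indicator (ball (x i) (r i)) z) \<partial>\<mu>)"
        by (intro nn_integral_sum[symmetric]) simp
      also have "\<dots> = (\<integral>\<^sup>+z. F z * indicator (\<Union>i\<in>J. ball (x i) (r i)) z \<partial>\<mu>)"
        using J(2) by (simp add: sum_distrib_left[symmetric] indicator_UN_disjoint)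
      also have "\<dots> \<le> (\<integral>\<^sup>+z. F z \<partial>\<mu>)"
        by (intro nn_integral_mono) (auto split: split_indicator)
      finally show ?thesis by (simp add: mult_left_mono)
    qed
    have "emeasure \<mu> (maximal_set F l) = (SUP n. emeasure \<mu> (\<Union>i\<in>{..n}. ball (x i) (r i)))"
      unfolding U by (rule SUP_emeasure_incseq[symmetric]) (auto simp: incseq_def intro: order_trans)
    then have "ennreal l * emeasure \<mu> (maximal_set F l)
        = (SUP n. ennreal l * emeasure \<mu> (\<Union>i\<in>{..n}. ball (x i) (r i)))"
      by (simp add: SUP_mult_left_ennreal)
    also have "\<dots> \<le> ennreal (D\<^sup>2) * (\<integral>\<^sup>+z. F z \<partial>\<mu>)"
      by (intro SUP_least fin)
    finally show ?thesis .
  qed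
qed

text \<open>
  The part of \<open>F\<close> below \<open>l / 2\<close> contributes at most \<open>l / 2\<close> to any average, so only the
  part above matters. This is the truncation of the Marcinkiewicz interpolation theorem.
\<close>

lemma maximal_set_weak_type_truncated:
  assumes [measurable]: "F \<in> borel_measurable \<mu>" and l: "0 < l"
  shows "emeasure \<mu> (maximal_set F l)
    \<le> ennreal (2 * D\<^sup>2 / l) * (\<integral>\<^sup>+z. F z * indicator {z. ennreal (l / 2) < F z} z \<partial>\<mu>)"
proof -
  let ?G = "\<lambda>z. F z * indicator {z. ennreal (l / 2) < F z} z"
  have sub: "maximal_set F l \<subseteq> maximal_set ?G (l / 2)"
  proof -
    have "ennreal (l / 2) * emeasure \<mu> (ball x r) < (\<integral>\<^sup>+z. ?G z * indicator (ball x r) z \<partial>\<mu>)"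
      if *: "ennreal l * emeasure \<mu> (ball x r) < (\<integral>\<^sup>+z. F z * indicator (ball x r) z \<partial>\<mu>)" for x r
    proof (rule ccontr)
      assume "\<not> ?thesis"
      then have G: "(\<integral>\<^sup>+z. ?G z * indicator (ball x r) z \<partial>\<mu>) \<le> ennreal (l / 2) * emeasure \<mu> (ball x r)"
        by simp
      have "(\<integral>\<^sup>+z. F z * indicator (ball x r) z \<partial>\<mu>)
          \<le> (\<integral>\<^sup>+z. ?G z * indicator (ball x r) z + ennreal (l / 2) * indicator (ball x r) z \<partial>\<mu>)"
        by (intro nn_integral_mono) (auto split: split_indicator)
      also have "\<dots> = (\<integral>\<^sup>+z. ?G z * indicator (ball x r) z \<partial>\<mu>) + ennreal (l / 2) * emeasure \<mu> (ball x r)"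
        by (subst nn_integral_add) (auto simp: nn_integral_cmult_indicator)
      also have "\<dots> \<le> ennreal (l / 2) * emeasure \<mu> (ball x r) + ennreal (l / 2) * emeasure \<mu> (ball x r)"
        using G by (rule add_right_mono)
      also have "\<dots> = ennreal l * emeasure \<mu> (ball x r)"
        using l by (simp add: distrib_right[symmetric] ennreal_plus[symmetric] del: ennreal_plus)
      finally show False using * by simp
    qed
    then show ?thesis unfolding maximal_set_def by (intro Union_mono) blast
  qed
  have "emeasure \<mu> (maximal_set F l) \<le> emeasure \<mu> (maximal_set ?G (l / 2))"
    by (intro emeasure_mono sub open_sets open_maximal_set)
  also have "\<dots> = ennreal (2 / l) * (ennreal (l / 2) * emeasure \<mu> (maximal_set ?G (l / 2)))"
    using l by (simp add: mult.assoc[symmetric] ennreal_mult[symmetric])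
  also have "\<dots> \<le> ennreal (2 / l) * (ennreal (D\<^sup>2) * (\<integral>\<^sup>+z. ?G z \<partial>\<mu>))"
    using l by (intro mult_left_mono maximal_set_weak_type) auto
  also have "\<dots> = ennreal (2 * D\<^sup>2 / l) * (\<integral>\<^sup>+z. ?G z \<partial>\<mu>)"
    using l by (simp add: mult.assoc[symmetric] ennreal_mult[symmetric])
  finally show ?thesis .
qed

end

text \<open>
  The strong type maximal inequality, summed over dyadic levels: the truncated weak type
  bounds add up to a geometric series at each point.
\<close>

lemma (in doubling_space) dyadic_maximal_strong_type:
  assumes [measurable]: "f \<in> borel_measurable \<mu>" and p: "1 < p" and M: "0 < M"
  shows "(\<integral>\<^sup>+k. ennreal (2 powr (real_of_int k * p)) *
        emeasure \<mu> (maximal_set (\<lambda>z. ennreal \<bar>f z\<bar>) (2 powr real_of_int k / M)) \<partial>count_space UNIV)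
    \<le> ennreal (D\<^sup>2 * (2 * M) powr p / (1 - 2 powr (1 - p))) * (\<integral>\<^sup>+z. ennreal (\<bar>f z\<bar> powr p) \<partial>\<mu>)"
proof -
  let ?F = "\<lambda>z. ennreal \<bar>f z\<bar>"
  let ?I = "\<lambda>k z. ennreal (2 powr (real_of_int k * (p - 1))) * indicator {k. 2 powr real_of_int k < 2 * M * \<bar>f z\<bar>} k"
  have "(\<integral>\<^sup>+k. ennreal (2 powr (real_of_int k * p)) *
        emeasure \<mu> (maximal_set ?F (2 powr real_of_int k / M)) \<partial>count_space UNIV)
      \<le> (\<integral>\<^sup>+k. (\<integral>\<^sup>+z. ennreal (2 * D\<^sup>2 * M) * (?F z * ?I k z) \<partial>\<mu>) \<partial>count_space UNIV)"
  proof (intro nn_integral_mono)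
    fix k :: int
    define l where "l = 2 powr real_of_int k / M"
    have l: "0 < l" using M by (simp add: l_def)
    have "ennreal (2 powr (real_of_int k * p)) * emeasure \<mu> (maximal_set ?F l)
        \<le> ennreal (2 powr (real_of_int k * p)) *
          (ennreal (2 * D\<^sup>2 / l) * (\<integral>\<^sup>+z. ?F z * indicator {z. ennreal (l / 2) < ?F z} z \<partial>\<mu>))"
      by (intro mult_left_mono maximal_set_weak_type_truncated l) auto
    also have "\<dots> = ennreal (2 powr (real_of_int k * p) * (2 * D\<^sup>2 / l)) *
        (\<integral>\<^sup>+z. ?F z * indicator {z. ennreal (l / 2) < ?F z} z \<partial>\<mu>)"
      using l by (simp add: ennreal_mult mult.assoc del: times_divide_eq_right)
    also have "2 powr (real_of_int k * p) * (2 * D\<^sup>2 / l) = (2 * D\<^sup>2 * M) * 2 powr (real_of_int k * (p - 1))"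
      using M by (simp add: l_def right_diff_distrib powr_diff)
    also have "ennreal \<dots> * (\<integral>\<^sup>+z. ?F z * indicator {z. ennreal (l / 2) < ?F z} z \<partial>\<mu>)
        = (\<integral>\<^sup>+z. ennreal (2 * D\<^sup>2 * M * 2 powr (real_of_int k * (p - 1))) *
            (?F z * indicator {z. ennreal (l / 2) < ?F z} z) \<partial>\<mu>)"
      by (intro nn_integral_cmult[symmetric]) measurable
    also have "\<dots> = (\<integral>\<^sup>+z. ennreal (2 * D\<^sup>2 * M) * (?F z * ?I k z) \<partial>\<mu>)"
      using M l by (intro nn_integral_cong)
        (auto simp: l_def ennreal_mult ennreal_less_iff field_simps split: split_indicator)
    finally show "ennreal (2 powr (real_of_int k * p)) * emeasure \<mu> (maximal_set ?F (2 powr real_of_int k / M))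
        \<le> (\<integral>\<^sup>+z. ennreal (2 * D\<^sup>2 * M) * (?F z * ?I k z) \<partial>\<mu>)"
      by (simp add: l_def)
  qed
  also have "\<dots> = (\<integral>\<^sup>+z. (\<integral>\<^sup>+k. ennreal (2 * D\<^sup>2 * M) * (?F z * ?I k z) \<partial>count_space UNIV) \<partial>\<mu>)"
    by (intro nn_integral_count_space_nn_integral[symmetric]) (simp_all add: indicator_def)
  also have "\<dots> \<le> (\<integral>\<^sup>+z. ennreal (D\<^sup>2 * (2 * M) powr p / (1 - 2 powr (1 - p))) * ennreal (\<bar>f z\<bar> powr p) \<partial>\<mu>)"
  proof (intro nn_integral_mono)
    fix z
    let ?R = "ennreal (D\<^sup>2 * (2 * M) powr p / (1 - 2 powr (1 - p))) * ennreal (\<bar>f z\<bar> powr p)"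
    have q: "2 powr (1 - p) < 1" using p by (simp add: powr_less_one)
    show "(\<integral>\<^sup>+k. ennreal (2 * D\<^sup>2 * M) * (?F z * ?I k z) \<partial>count_space UNIV) \<le> ?R"
    proof (cases "f z = 0")
      case False
      then have v: "0 < 2 * M * \<bar>f z\<bar>" using M by simp
      have "(\<integral>\<^sup>+k. ennreal (2 * D\<^sup>2 * M) * (?F z * ?I k z) \<partial>count_space UNIV)
          = ennreal (2 * D\<^sup>2 * M) * (?F z * (\<integral>\<^sup>+k. ?I k z \<partial>count_space UNIV))"
        by (simp add: nn_integral_cmult)
      also have "\<dots> \<le> ennreal (2 * D\<^sup>2 * M) *
          (?F z * ennreal ((2 * M * \<bar>f z\<bar>) powr (p - 1) / (1 - 2 powr (- (p - 1)))))"
        using p v by (intro mult_left_mono dyadic_sum_below) auto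
      also have "\<dots> = ennreal (2 * D\<^sup>2 * M * (\<bar>f z\<bar> * ((2 * M * \<bar>f z\<bar>) powr (p - 1) / (1 - 2 powr (1 - p)))))"
        using M q by (simp add: ennreal_mult[symmetric])
      also have "2 * D\<^sup>2 * M * (\<bar>f z\<bar> * ((2 * M * \<bar>f z\<bar>) powr (p - 1) / (1 - 2 powr (1 - p))))
          = D\<^sup>2 * (2 * M) powr p / (1 - 2 powr (1 - p)) * \<bar>f z\<bar> powr p"
        using M False by (simp add: powr_diff powr_mult)
      also have "ennreal \<dots> = ?R"
        using q by (intro ennreal_mult) auto
      finally show ?thesis .
    qed simp
  qed
  also have "\<dots> = ennreal (D\<^sup>2 * (2 * M) powr p / (1 - 2 powr (1 - p))) * (\<integral>\<^sup>+z. ennreal (\<bar>f z\<bar> powr p) \<partial>\<mu>)"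
    by (rule nn_integral_cmult) measurable
  finally show ?thesis .
qed

section \<open>Bounds for the fractional heat extension\<close>

text \<open>A Gaussian is dominated by a polynomial profile; only the volume growth has to be beaten.\<close>

lemma gaussian_le_polynomial:
  fixes C N v :: real
  assumes "0 < C" "0 \<le> N" "0 \<le> v"
  shows "exp (- C * v\<^sup>2) \<le> exp (N\<^sup>2 / (4 * C)) * (1 + v) powr (- N)"
proof -
  have "N * v - C * v\<^sup>2 = N\<^sup>2 / (4 * C) - (2 * C * v - N)\<^sup>2 / (4 * C)"
    using assms(1) by (simp add: field_simps power2_eq_square)
  also have "\<dots> \<le> N\<^sup>2 / (4 * C)" using assms(1) by simp
  finally have 1: "- C * v\<^sup>2 \<le> N\<^sup>2 / (4 * C) - N * v" by simp
  have "N * ln (1 + v) \<le> N * v"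
    using assms by (intro mult_left_mono ln_add_one_self_le_self) auto
  then have "- C * v\<^sup>2 \<le> N\<^sup>2 / (4 * C) + - N * ln (1 + v)" using 1 by simp
  then have "exp (- C * v\<^sup>2) \<le> exp (N\<^sup>2 / (4 * C) + - N * ln (1 + v))" by simp
  then show ?thesis using assms(3) by (simp only: exp_add) (simp add: powr_def)
qed

locale frac_heat = doubling_space +
  fixes h :: "real \<Rightarrow> 'a \<Rightarrow> 'a \<Rightarrow> real" and \<eta> :: "real \<Rightarrow> real \<Rightarrow> real" and \<alpha> C c1 c2 :: real
  assumes alpha: "0 < \<alpha>"
    and density: "subordination_density \<alpha> \<eta>"
    and h_measurable: "(\<lambda>(t, x, y). h t x y) \<in>
        borel_measurable (restrict_space borel {0<..} \<Otimes>\<^sub>M (\<mu> \<Otimes>\<^sub>M \<mu>))"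
    and C_pos: "0 < C" and c1_pos: "0 < c1" and c2_pos: "0 < c2"
    and h_lower: "0 < s \<Longrightarrow> c1 / vol x (sqrt s) * exp (- C * (dist x y)\<^sup>2 / s) \<le> h s x y"
    and h_upper: "0 < s \<Longrightarrow> h s x y \<le> c2 / vol x (sqrt s) * exp (- C * (dist x y)\<^sup>2 / s)"
begin

sublocale sigma_finite_measure \<mu> by (rule sigma_finite)

lemma h_nonneg: "0 < s \<Longrightarrow> 0 \<le> h s x y"
  using c1_pos vol_nonneg[of x "sqrt s"] by (intro order_trans[OF _ h_lower]) auto

lemma eta_nonneg: "0 < t \<Longrightarrow> 0 < s \<Longrightarrow> 0 \<le> \<eta> t s"
proof -
  have "\<forall>t>0. \<forall>s>0. 0 \<le> \<eta> t s"
    using density unfolding subordination_density_def by (elim conjE) assumption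
  then show "0 < t \<Longrightarrow> 0 < s \<Longrightarrow> 0 \<le> \<eta> t s" by blast
qed

lemma eta_scaling:
  assumes "0 < t" "0 < s"
  shows "\<eta> t s = t powr (- (1 / \<alpha>)) * \<eta> 1 (s / t powr (1 / \<alpha>))"
proof -
  have "\<forall>t>0. \<forall>s>0. \<eta> t s = t powr (- 1 / \<alpha>) * \<eta> 1 (s / t powr (1 / \<alpha>))"
    using density unfolding subordination_density_def by (elim conjE) assumption
  from this[rule_format, OF assms] show ?thesis by (simp only: minus_divide_left)
qed

text \<open>The spatial radius of parabolic scaling at time \<open>t\<close>.\<close>

definition rad :: "real \<Rightarrow> real" where
  "rad t = t powr (1 / (2 * \<alpha>))"

lemma rad_pos: "0 < t \<Longrightarrow> 0 < rad t"
  by (simp add: rad_def)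

lemma rad_square: "0 < t \<Longrightarrow> (rad t)\<^sup>2 = t powr (1 / \<alpha>)"
  by (simp add: rad_def power2_eq_square powr_add[symmetric])

text \<open>
  Extensions by zero to all times: they are measurable on the whole line, and the subordination
  integral becomes an integral over the line.
\<close>

definition h0 :: "real \<Rightarrow> 'a \<Rightarrow> 'a \<Rightarrow> real" where
  "h0 s x y = (if 0 < s then h s x y else 0)"

definition eta0 :: "real \<Rightarrow> real \<Rightarrow> real" where
  "eta0 t s = (if 0 < t \<and> 0 < s then \<eta> t s else 0)"

lemma h0_measurable [measurable]:
  "(\<lambda>(s, x, y). h0 s x y) \<in> borel_measurable (borel \<Otimes>\<^sub>M (\<mu> \<Otimes>\<^sub>M \<mu>))"
proof -
  have 1: "(\<lambda>s::real. if 0 < s then s else 1) \<in> borel \<rightarrow>\<^sub>M restrict_space borel {0<..}"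
    by (rule measurable_restrict_space2) auto
  have "(\<lambda>w. (if 0 < fst w then fst w else 1::real, snd w)) \<in>
      borel \<Otimes>\<^sub>M (\<mu> \<Otimes>\<^sub>M \<mu>) \<rightarrow>\<^sub>M restrict_space borel {0<..} \<Otimes>\<^sub>M (\<mu> \<Otimes>\<^sub>M \<mu>)"
    using measurable_compose[OF measurable_fst 1] by (intro measurable_Pair) auto
  from measurable_compose[OF this h_measurable]
  have [measurable]: "(\<lambda>w. h (if 0 < fst w then fst w else 1) (fst (snd w)) (snd (snd w)))
      \<in> borel_measurable (borel \<Otimes>\<^sub>M (\<mu> \<Otimes>\<^sub>M \<mu>))" by (simp add: case_prod_beta)
  have "(\<lambda>w. if 0 < fst w then h (if 0 < fst w then fst w else 1) (fst (snd w)) (snd (snd w)) else 0)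
      \<in> borel_measurable (borel \<Otimes>\<^sub>M (\<mu> \<Otimes>\<^sub>M \<mu>))" by measurable
  then show ?thesis
    by (rule measurable_cong[THEN iffD1, rotated]) (auto simp: h0_def)
qed

lemma eta0_measurable [measurable]: "(\<lambda>(t, s). eta0 t s) \<in> borel_measurable (borel \<Otimes>\<^sub>M borel)"
proof -
  have "continuous_on {0<..} (\<eta> 1)" using density unfolding subordination_density_def by simp
  then have "(\<lambda>s. indicator {0<..} s *\<^sub>R \<eta> 1 s) \<in> borel_measurable borel"
    by (intro borel_measurable_continuous_on_indicator) auto
  then have [measurable]: "(\<lambda>s. indicator {0<..} s * \<eta> 1 s) \<in> borel_measurable borel" by simp
  have "(\<lambda>w. if 0 < fst w \<and> 0 < snd w then fst w powr (- (1 / \<alpha>)) *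
      (\<lambda>s. indicator {0<..} s * \<eta> 1 s) (snd w / fst w powr (1 / \<alpha>)) else 0)
      \<in> borel_measurable (borel \<Otimes>\<^sub>M borel)" by measurable
  then show ?thesis
    by (rule measurable_cong[THEN iffD1, rotated]) (auto simp: eta0_def eta_scaling[symmetric])
qed

lemma frac_kernel_eq: "0 < t \<Longrightarrow> frac_kernel \<eta> h t x y = (LINT s|lborel. eta0 t s * h0 s x y)"
  unfolding frac_kernel_def set_lebesgue_integral_def
  by (intro Bochner_Integration.integral_cong) (auto simp: eta0_def h0_def)

lemma eta0_h0_nonneg: "0 \<le> eta0 t s * h0 s x y"
  by (simp add: eta0_def h0_def eta_nonneg h_nonneg)

lemma kernel_measurable [measurable]:
  "(\<lambda>w. LINT s|lborel. eta0 (fst (fst w)) s * h0 s (snd (fst w)) (snd w)) \<in> borel_measurable ((borel \<Otimes>\<^sub>M \<mu>) \<Otimes>\<^sub>M \<mu>)"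
proof -
  have [measurable]: "(\<lambda>w. h0 (snd w) (snd (fst (fst w))) (snd (fst w)))
      \<in> borel_measurable (((borel \<Otimes>\<^sub>M \<mu>) \<Otimes>\<^sub>M \<mu>) \<Otimes>\<^sub>M lborel)"
    using measurable_compose[OF _ h0_measurable, of "\<lambda>w. (snd w, snd (fst (fst w)), snd (fst w))"
        "((borel \<Otimes>\<^sub>M \<mu>) \<Otimes>\<^sub>M \<mu>) \<Otimes>\<^sub>M lborel"] by simp
  have [measurable]: "(\<lambda>w. eta0 (fst (fst (fst w))) (snd w))
      \<in> borel_measurable (((borel \<Otimes>\<^sub>M \<mu>) \<Otimes>\<^sub>M \<mu>) \<Otimes>\<^sub>M lborel)"
    using measurable_compose[OF _ eta0_measurable, of "\<lambda>w. (fst (fst (fst w)), snd w)"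
        "((borel \<Otimes>\<^sub>M \<mu>) \<Otimes>\<^sub>M \<mu>) \<Otimes>\<^sub>M lborel"] by simp
  show ?thesis
    by (rule lborel.borel_measurable_lebesgue_integral) (simp add: case_prod_beta')
qed

lemma frac_extension_measurable:
  assumes [measurable]: "f \<in> borel_measurable \<mu>" and \<nu>: "sets \<nu> = sets (restrict_space borel upper_half)"
  shows "frac_extension \<mu> \<eta> h f \<in> borel_measurable \<nu>"
proof -
  have sp: "space \<nu> = upper_half"
    using sets_eq_imp_space_eq[OF \<nu>] by (simp add: space_restrict_space)
  have "(\<lambda>z. LINT y|\<mu>. (LINT s|lborel. eta0 (fst z) s * h0 s (snd z) y) * f y) \<in> borel_measurable (borel \<Otimes>\<^sub>M \<mu>)"
  proof (rule borel_measurable_lebesgue_integral)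
    show "(\<lambda>(z, y). (LINT s|lborel. eta0 (fst z) s * h0 s (snd z) y) * f y) \<in> borel_measurable ((borel \<Otimes>\<^sub>M \<mu>) \<Otimes>\<^sub>M \<mu>)"
      using kernel_measurable by (simp add: case_prod_beta')
  qed
  moreover have "sets (borel \<Otimes>\<^sub>M \<mu>) = sets (borel :: (real \<times> 'a) measure)"
    by (subst borel_prod[symmetric]) (intro sets_pair_measure_cong refl sets_borel)
  ultimately have "(\<lambda>z. LINT y|\<mu>. (LINT s|lborel. eta0 (fst z) s * h0 s (snd z) y) * f y) \<in> borel_measurable borel"
    using measurable_cong_sets[OF _ refl] by blast
  then have "(\<lambda>z. LINT y|\<mu>. (LINT s|lborel. eta0 (fst z) s * h0 s (snd z) y) * f y) \<in> borel_measurable \<nu>"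
    using measurable_cong_sets[OF \<nu> refl] measurable_restrict_space1 by blast
  then show ?thesis
    by (rule measurable_cong[THEN iffD1, rotated])
       (auto simp: sp upper_half_def frac_extension_def frac_kernel_eq)
qed

end

context frac_heat
begin

text \<open>
  Replacing a ball of radius \<open>\<surd>s\<close> by one of radius \<open>\<surd>s + rad t\<close> costs at most a multiple of
  this weight in volume. By scaling, its integral against the subordination density does
  not depend on \<open>t\<close>.
\<close>

definition weight :: "real \<Rightarrow> real \<Rightarrow> real" where
  "weight t s = (1 + rad t / sqrt s) powr growth"

lemma weight_nonneg: "0 \<le> weight t s"
  by (simp add: weight_def)

lemma weight_measurable [measurable]: "weight t \<in> borel_measurable borel"
  unfolding weight_def by measurable

lemma eta0_measurable_right [measurable]: "eta0 t \<in> borel_measurable borel"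
  using measurable_compose[OF _ eta0_measurable, of "\<lambda>s. (t, s)" borel] by simp

lemma eta0_nonneg: "0 \<le> eta0 t s"
  by (simp add: eta0_def eta_nonneg)

lemma eta0_integral: "(\<integral>\<^sup>+s. ennreal (eta0 1 s) \<partial>lborel) = 1"
proof -
  have *: "\<forall>t>0. \<forall>l\<ge>0. (\<integral>\<^sup>+ s\<in>{0<..}. ennreal (exp (- s * l) * \<eta> t s) \<partial>lborel)
                     = ennreal (exp (- t * l powr \<alpha>))"
    using density unfolding subordination_density_def by (elim conjE) assumption
  have "(\<integral>\<^sup>+s. ennreal (eta0 1 s) \<partial>lborel) = (\<integral>\<^sup>+ s\<in>{0<..}. ennreal (exp (- s * 0) * \<eta> 1 s) \<partial>lborel)"
    by (intro nn_integral_cong) (auto simp: eta0_def split: split_indicator)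
  also have "\<dots> = 1" using *[rule_format, of 1 0] by simp
  finally show ?thesis .
qed

lemma eta0_moment_finite:
  assumes "0 < \<gamma>"
  shows "(\<integral>\<^sup>+s. ennreal (s powr (- \<gamma>) * eta0 1 s) \<partial>lborel) < \<infinity>"
proof -
  have *: "\<forall>\<gamma>>0. (\<integral>\<^sup>+ s\<in>{0<..}. ennreal (s powr (- \<gamma>) * \<eta> 1 s) \<partial>lborel) < \<infinity>"
    using density unfolding subordination_density_def by (elim conjE) assumption
  have "(\<integral>\<^sup>+s. ennreal (s powr (- \<gamma>) * eta0 1 s) \<partial>lborel)
      = (\<integral>\<^sup>+ s\<in>{0<..}. ennreal (s powr (- \<gamma>) * \<eta> 1 s) \<partial>lborel)"
    by (intro nn_integral_cong) (auto simp: eta0_def split: split_indicator)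
  then show ?thesis using *[rule_format, OF assms] by simp
qed

lemma weight_moment_bound:
  "\<exists>J>0. \<forall>t>0. (\<integral>\<^sup>+s. ennreal (eta0 t s * weight t s) \<partial>lborel) \<le> ennreal J"
proof -
  let ?G = "\<lambda>u. ennreal (eta0 1 u * weight 1 u)"
  have r1: "rad 1 = 1" by (simp add: rad_def)
  have G_le: "?G u \<le> ennreal (2 powr growth) * (ennreal (eta0 1 u) + ennreal (u powr (- (growth / 2)) * eta0 1 u))" for u
  proof (cases "0 < u")
    case True
    define w where "w = 1 / sqrt u"
    have w: "0 \<le> w" using True by (simp add: w_def)
    have "(1 + w) powr growth \<le> (2 * max 1 w) powr growth"
      using w growth_pos by (intro powr_mono2) auto
    also have "\<dots> = 2 powr growth * max 1 w powr growth" by (simp add: powr_mult)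
    also have "max 1 w powr growth \<le> 1 + w powr growth" by (auto simp: max_def)
    also have "w powr growth = u powr (- (growth / 2))"
      using True by (simp add: w_def powr_half_sqrt[symmetric] powr_minus_divide[symmetric] powr_powr)
    finally have "weight 1 u \<le> 2 powr growth * (1 + u powr (- (growth / 2)))"
      by (simp add: weight_def r1 w_def)
    then have "eta0 1 u * weight 1 u \<le> eta0 1 u * (2 powr growth * (1 + u powr (- (growth / 2))))"
      by (rule mult_left_mono) (rule eta0_nonneg)
    also have "\<dots> = 2 powr growth * (eta0 1 u + u powr (- (growth / 2)) * eta0 1 u)"
      by (simp add: algebra_simps)
    finally show ?thesis
      by (simp add: eta0_nonneg ennreal_mult[symmetric] ennreal_plus[symmetric] ennreal_leI del: ennreal_plus)
  qed (simp add: eta0_def)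
  have "(\<integral>\<^sup>+u. ?G u \<partial>lborel)
      \<le> (\<integral>\<^sup>+u. ennreal (2 powr growth) * (ennreal (eta0 1 u) + ennreal (u powr (- (growth / 2)) * eta0 1 u)) \<partial>lborel)"
    by (intro nn_integral_mono G_le)
  also have "\<dots> = ennreal (2 powr growth) * (1 + (\<integral>\<^sup>+u. ennreal (u powr (- (growth / 2)) * eta0 1 u) \<partial>lborel))"
    by (simp add: nn_integral_cmult nn_integral_add eta0_integral)
  also have "\<dots> < \<infinity>"
    using eta0_moment_finite[of "growth / 2"] growth_pos by (simp add: ennreal_mult_less_top)
  finally have fin: "(\<integral>\<^sup>+u. ?G u \<partial>lborel) < \<infinity>" .
  have scale: "(\<integral>\<^sup>+s. ennreal (eta0 t s * weight t s) \<partial>lborel) = (\<integral>\<^sup>+u. ?G u \<partial>lborel)" if t: "0 < t" for t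
  proof -
    define a where "a = t powr (1 / \<alpha>)"
    have a: "0 < a" using t by (simp add: a_def)
    have "rad t = sqrt a"
      using rad_square[OF t] rad_pos[OF t] by (simp add: a_def real_sqrt_unique)
    then have w: "weight t (a * u) = weight 1 u" if "0 < u" for u
      using a that by (simp add: weight_def r1 real_sqrt_mult)
    have e: "eta0 t (a * u) = eta0 1 u / a" for u
    proof (cases "0 < u")
      case True
      then show ?thesis
        using t a eta_scaling[of t "a * u"] by (simp add: eta0_def a_def powr_minus_divide)
    qed (use a in \<open>simp add: eta0_def zero_less_mult_iff\<close>)
    have "(\<integral>\<^sup>+s. ennreal (eta0 t s * weight t s) \<partial>lborel)
        = ennreal \<bar>a\<bar> * (\<integral>\<^sup>+u. ennreal (eta0 t (0 + a * u) * weight t (0 + a * u)) \<partial>lborel)"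
      using a by (intro nn_integral_real_affine) auto
    also have "\<dots> = (\<integral>\<^sup>+u. ennreal a * ennreal (eta0 t (a * u) * weight t (a * u)) \<partial>lborel)"
      using a by (subst nn_integral_cmult) auto
    also have "\<dots> = (\<integral>\<^sup>+u. ?G u \<partial>lborel)"
    proof (intro nn_integral_cong)
      fix u
      show "ennreal a * ennreal (eta0 t (a * u) * weight t (a * u)) = ?G u"
      proof (cases "0 < u")
        case True
        then show ?thesis using a w[of u] eta0_nonneg[of 1 u] weight_nonneg[of 1 u]
          by (simp add: e ennreal_mult[symmetric])
      next
        case False
        then have "eta0 1 u = 0" by (simp add: eta0_def)
        then show ?thesis by (simp add: e)
      qed
    qed
    finally show ?thesis .
  qed
  have "(\<integral>\<^sup>+u. ?G u \<partial>lborel) \<le> ennreal (enn2real (\<integral>\<^sup>+u. ?G u \<partial>lborel) + 1)"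
    using fin by (cases "\<integral>\<^sup>+u. ?G u \<partial>lborel") (auto intro: ennreal_leI)
  moreover have "0 < enn2real (\<integral>\<^sup>+u. ?G u \<partial>lborel) + 1"
    by (simp add: add_nonneg_pos)
  ultimately show ?thesis
    by (intro exI[of _ "enn2real (\<integral>\<^sup>+u. ?G u \<partial>lborel) + 1"] conjI allI impI)
       (auto intro: ord_eq_le_trans[OF scale])
qed

text \<open>
  The constant in the polynomial bound of order \<open>growth + 1\<close> for the Gaussian, times the loss
  from rounding a distance up to a dyadic radius; one order more than the volume growth makes
  the dyadic sums converge.
\<close>

definition gauss_const :: real where
  "gauss_const = exp ((growth + 1)\<^sup>2 / (4 * C)) * 2 powr (growth + 1)"

text \<open>A Gaussian as a superposition of dyadic balls, with weights that beat the volume growth.\<close>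

lemma gaussian_le_dyadic_balls:
  assumes s: "0 < s"
  shows "ennreal (exp (- C * (dist x z)\<^sup>2 / s))
    \<le> (\<Sum>k. ennreal (gauss_const * 2 powr (- (real k * (growth + 1)))) * indicator (ball x (2 ^ k * sqrt s)) z)"
proof -
  define v where "v = dist x z / sqrt s"
  let ?g = "\<lambda>k. ennreal (gauss_const * 2 powr (- (real k * (growth + 1)))) * indicator (ball x (2 ^ k * sqrt s)) z"
  have v: "0 \<le> v" using s by (simp add: v_def)
  have v2: "v\<^sup>2 = (dist x z)\<^sup>2 / s" using s by (simp add: v_def power_divide)
  have "\<exists>k::nat. v < 2 ^ k"
    using real_arch_pow[of 2 v] by auto
  then obtain k :: nat where k: "v < 2 ^ k" "\<And>j. j < k \<Longrightarrow> 2 ^ j \<le> v"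
    using exists_least_iff[of "\<lambda>k. v < 2 ^ k"] by (auto simp: not_less)
  have lower: "2 powr (real k - 1) \<le> 1 + v"
  proof (cases k)
    case 0
    then show ?thesis using v by (simp add: powr_minus_divide)
  next
    case (Suc j)
    then show ?thesis using k(2)[of j] by (simp add: powr_realpow)
  qed
  have "exp (- C * v\<^sup>2) \<le> exp ((growth + 1)\<^sup>2 / (4 * C)) * (1 + v) powr (- (growth + 1))"
    using C_pos growth_pos v by (intro gaussian_le_polynomial) auto
  also have "\<dots> \<le> exp ((growth + 1)\<^sup>2 / (4 * C)) * (2 powr (real k - 1)) powr (- (growth + 1))"
    using lower growth_pos v by (intro mult_left_mono powr_mono2') auto
  also have "\<dots> = gauss_const * 2 powr (- (real k * (growth + 1)))"
    by (simp add: gauss_const_def powr_powr powr_add[symmetric] algebra_simps)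
  finally have "ennreal (exp (- C * v\<^sup>2)) \<le> ennreal (gauss_const * 2 powr (- (real k * (growth + 1))))"
    by (rule ennreal_leI)
  moreover have "- C * (dist x z)\<^sup>2 / s = - C * v\<^sup>2" by (simp add: v2)
  moreover have "z \<in> ball x (2 ^ k * sqrt s)"
    using k(1) s by (simp add: v_def pos_divide_less_eq)
  ultimately have "ennreal (exp (- C * (dist x z)\<^sup>2 / s)) \<le> ?g k" by simp
  also have "\<dots> = sum ?g {k}"
    by (simp only: sum.insert finite.emptyI empty_iff not_False_eq_True sum.empty add_0_right)
  also have "\<dots> \<le> (\<Sum>k. ?g k)" by (rule sum_le_suminf) auto
  finally show ?thesis .
qed

definition heat_const :: real where
  "heat_const = 2 * c2 * D * gauss_const"

lemma heat_const_pos: "0 < heat_const"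
  unfolding heat_const_def gauss_const_def using c2_pos D_ge by simp

text \<open>
  Each ball about \<open>x\<close>, enlarged by \<open>\<rho>\<close>, contains \<open>y\<close>, so that the averages of \<open>F\<close> over
  these balls are controlled by the level of the maximal function at \<open>y\<close>.
\<close>

lemma heat_average_le:
  assumes [measurable]: "F \<in> borel_measurable \<mu>" and s: "0 < s" and \<rho>: "0 < \<rho>" and l: "0 \<le> l"
    and y: "y \<notin> maximal_set F l" "y \<in> ball x \<rho>"
  shows "(\<integral>\<^sup>+z. ennreal (h s x z) * F z \<partial>\<mu>) \<le> ennreal (heat_const * (1 + \<rho> / sqrt s) powr growth * l)"
proof -
  let ?\<sigma> = "sqrt s"
  let ?b = "\<lambda>k::nat. gauss_const * 2 powr (- (real k * (growth + 1)))"
  have prof: "0 \<le> gauss_const" by (simp add: gauss_const_def)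
  have V: "0 < vol x ?\<sigma>" using s by (simp add: vol_pos)
  have ball: "(\<integral>\<^sup>+z. F z * indicator (ball x (2 ^ k * ?\<sigma>)) z \<partial>\<mu>)
      \<le> ennreal (D * (2 ^ k * (1 + \<rho> / ?\<sigma>)) powr growth * vol x ?\<sigma> * l)" for k :: nat
  proof -
    let ?R = "2 ^ k * ?\<sigma> + \<rho>"
    have p2: "(1::real) \<le> 2 ^ k" by simp
    have "1 * ?\<sigma> \<le> 2 ^ k * ?\<sigma>" using s by (intro mult_right_mono p2) simp
    then have R: "?\<sigma> \<le> ?R" using \<rho> by linarith
    have "(\<integral>\<^sup>+z. F z * indicator (ball x (2 ^ k * ?\<sigma>)) z \<partial>\<mu>) \<le> (\<integral>\<^sup>+z. F z * indicator (ball x ?R) z \<partial>\<mu>)"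
      using \<rho> by (intro nn_integral_mono) (auto split: split_indicator)
    also have "\<dots> \<le> ennreal l * emeasure \<mu> (ball x ?R)"
    proof (rule average_le_outside_maximal_set[OF y(1)])
      have "0 \<le> 2 ^ k * ?\<sigma>" using s by simp
      then show "y \<in> ball x ?R" using y(2) by simp
    qed
    also have "\<dots> = ennreal (l * vol x ?R)"
      using l by (simp add: emeasure_ball ennreal_mult vol_nonneg)
    also have "\<dots> \<le> ennreal (l * (D * (2 ^ k * (1 + \<rho> / ?\<sigma>)) powr growth * vol x ?\<sigma>))"
    proof (intro ennreal_leI mult_left_mono l)
      have "?R / ?\<sigma> = 2 ^ k + \<rho> / ?\<sigma>" using s by (simp add: field_simps)
      also have "\<dots> \<le> 2 ^ k * (1 + \<rho> / ?\<sigma>)"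
        using mult_right_mono[OF p2, of "\<rho> / ?\<sigma>"] s \<rho> by (simp add: distrib_left)
      finally have "(?R / ?\<sigma>) powr growth \<le> (2 ^ k * (1 + \<rho> / ?\<sigma>)) powr growth"
        using s \<rho> growth_pos by (intro powr_mono2) auto
      then have "D * (?R / ?\<sigma>) powr growth * vol x ?\<sigma> \<le> D * (2 ^ k * (1 + \<rho> / ?\<sigma>)) powr growth * vol x ?\<sigma>"
        using D_ge V by (intro mult_right_mono mult_left_mono) auto
      moreover have "vol x ?R \<le> D * (?R / ?\<sigma>) powr growth * vol x ?\<sigma>"
        using s R by (intro vol_growth) auto
      ultimately show "vol x ?R \<le> D * (2 ^ k * (1 + \<rho> / ?\<sigma>)) powr growth * vol x ?\<sigma>" by simp
    qed
    finally show ?thesis by (simp add: mult_ac)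
  qed
  have "(\<integral>\<^sup>+z. ennreal (h s x z) * F z \<partial>\<mu>)
      \<le> (\<integral>\<^sup>+z. (\<Sum>k. ennreal (c2 / vol x ?\<sigma> * ?b k) * (F z * indicator (ball x (2 ^ k * ?\<sigma>)) z)) \<partial>\<mu>)"
  proof (intro nn_integral_mono)
    fix z
    have "ennreal (h s x z) \<le> ennreal (c2 / vol x ?\<sigma>) * ennreal (exp (- C * (dist x z)\<^sup>2 / s))"
      using h_upper[OF s, of x z] c2_pos V by (simp add: ennreal_mult[symmetric] ennreal_leI)
    also have "\<dots> \<le> ennreal (c2 / vol x ?\<sigma>) * (\<Sum>k. ennreal (?b k) * indicator (ball x (2 ^ k * ?\<sigma>)) z)"
      by (intro mult_left_mono gaussian_le_dyadic_balls[OF s]) simp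
    finally have "ennreal (h s x z) * F z
        \<le> ennreal (c2 / vol x ?\<sigma>) * (\<Sum>k. ennreal (?b k) * indicator (ball x (2 ^ k * ?\<sigma>)) z) * F z"
      by (rule mult_right_mono) simp
    also have "\<dots> = (\<Sum>k. ennreal (c2 / vol x ?\<sigma>) * (ennreal (?b k) * indicator (ball x (2 ^ k * ?\<sigma>)) z) * F z)"
      by (simp only: ennreal_suminf_cmult ennreal_suminf_multc)
    also have "\<dots> = (\<Sum>k. ennreal (c2 / vol x ?\<sigma> * ?b k) * (F z * indicator (ball x (2 ^ k * ?\<sigma>)) z))"
      using c2_pos V prof by (intro suminf_cong) (simp add: ennreal_mult mult_ac del: times_divide_eq_left times_divide_eq_right)
    finally show "ennreal (h s x z) * F z
        \<le> (\<Sum>k. ennreal (c2 / vol x ?\<sigma> * ?b k) * (F z * indicator (ball x (2 ^ k * ?\<sigma>)) z))" .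
  qed
  also have "\<dots> = (\<Sum>k. ennreal (c2 / vol x ?\<sigma> * ?b k) * (\<integral>\<^sup>+z. F z * indicator (ball x (2 ^ k * ?\<sigma>)) z \<partial>\<mu>))"
    by (simp add: nn_integral_suminf nn_integral_cmult)
  also have "\<dots> \<le> (\<Sum>k. ennreal (c2 / vol x ?\<sigma> * ?b k) * ennreal (D * (2 ^ k * (1 + \<rho> / ?\<sigma>)) powr growth * vol x ?\<sigma> * l))"
    by (intro suminf_le mult_left_mono ball) auto
  also have "\<dots> = (\<Sum>k. ennreal (c2 * D * gauss_const * (1 + \<rho> / ?\<sigma>) powr growth * l * (1 / 2) ^ k))"
  proof (intro suminf_cong)
    fix k :: nat
    have pw: "?b k * (2 ^ k * (1 + \<rho> / ?\<sigma>)) powr growth = gauss_const * (1 + \<rho> / ?\<sigma>) powr growth * (1 / 2) ^ k"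
    proof -
      have "(2 ^ k * (1 + \<rho> / ?\<sigma>)) powr growth = 2 powr (real k * growth) * (1 + \<rho> / ?\<sigma>) powr growth"
        using s \<rho> by (simp add: powr_mult powr_realpow[symmetric] powr_powr)
      moreover have "2 powr (- (real k * (growth + 1))) * 2 powr (real k * growth) = (1 / 2 :: real) ^ k"
        by (simp add: powr_add[symmetric] algebra_simps powr_minus powr_realpow power_one_over inverse_eq_divide)
      ultimately show ?thesis by (simp add: mult_ac)
    qed
    have "ennreal (c2 / vol x ?\<sigma> * ?b k) * ennreal (D * (2 ^ k * (1 + \<rho> / ?\<sigma>)) powr growth * vol x ?\<sigma> * l)
        = ennreal ((c2 / vol x ?\<sigma> * ?b k) * (D * (2 ^ k * (1 + \<rho> / ?\<sigma>)) powr growth * vol x ?\<sigma> * l))"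
      using c2_pos V prof D_ge l by (intro ennreal_mult[symmetric] mult_nonneg_nonneg) auto
    also have "(c2 / vol x ?\<sigma> * ?b k) * (D * (2 ^ k * (1 + \<rho> / ?\<sigma>)) powr growth * vol x ?\<sigma> * l)
        = c2 * D * l * (?b k * (2 ^ k * (1 + \<rho> / ?\<sigma>)) powr growth)"
      using V by simp
    also have "\<dots> = c2 * D * gauss_const * (1 + \<rho> / ?\<sigma>) powr growth * l * (1 / 2) ^ k"
      unfolding pw by (simp add: mult_ac)
    finally show "ennreal (c2 / vol x ?\<sigma> * ?b k) * ennreal (D * (2 ^ k * (1 + \<rho> / ?\<sigma>)) powr growth * vol x ?\<sigma> * l)
        = ennreal (c2 * D * gauss_const * (1 + \<rho> / ?\<sigma>) powr growth * l * (1 / 2) ^ k)" .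
  qed
  also have "\<dots> = ennreal (\<Sum>k. c2 * D * gauss_const * (1 + \<rho> / ?\<sigma>) powr growth * l * (1 / 2) ^ k)"
    using c2_pos D_ge prof l by (intro suminf_ennreal2 summable_mult summable_geometric mult_nonneg_nonneg) auto
  also have "(\<Sum>k. c2 * D * gauss_const * (1 + \<rho> / ?\<sigma>) powr growth * l * (1 / 2) ^ k)
      = heat_const * (1 + \<rho> / ?\<sigma>) powr growth * l"
    by (subst suminf_mult) (auto simp: suminf_geometric heat_const_def)
  finally show ?thesis .
qed

lemma frac_kernel_nonneg: "0 < t \<Longrightarrow> 0 \<le> frac_kernel \<eta> h t x y"
  by (simp add: frac_kernel_eq eta0_h0_nonneg)

lemma h0_measurable_left [measurable]: "(\<lambda>s. h0 s x y) \<in> borel_measurable borel"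
  using measurable_compose[OF _ h0_measurable, of "\<lambda>s. (s, x, y)" borel] by (simp add: space_UNIV)

lemma h0_measurable_outer [measurable]: "(\<lambda>(s, z). h0 s x z) \<in> borel_measurable (borel \<Otimes>\<^sub>M \<mu>)"
  using measurable_compose[OF _ h0_measurable, of "\<lambda>w. (fst w, x, snd w)" "borel \<Otimes>\<^sub>M \<mu>"]
  by (simp add: space_UNIV case_prod_beta')

lemma frac_kernel_measurable_right:
  assumes "0 < t"
  shows "frac_kernel \<eta> h t x \<in> borel_measurable \<mu>"
proof -
  have "frac_kernel \<eta> h t x = (\<lambda>y. LINT s|lborel. eta0 t s * h0 s x y)"
    using assms by (intro ext) (rule frac_kernel_eq)
  then show ?thesis
    using measurable_compose[OF _ kernel_measurable, of "\<lambda>y. ((t, x), y)" \<mu>]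
    by (simp add: space_UNIV)
qed

lemma nn_integral_kernel_finite:
  assumes t: "0 < t"
  shows "(\<integral>\<^sup>+s. ennreal (eta0 t s * h0 s x y) \<partial>lborel) < \<infinity>"
proof -
  obtain J where J: "(\<integral>\<^sup>+s. ennreal (eta0 t s * weight t s) \<partial>lborel) \<le> ennreal J"
    using weight_moment_bound t by blast
  let ?A = "c2 * D / vol x (rad t)"
  have V: "0 < vol x (rad t)" using rad_pos[OF t] by (rule vol_pos)
  have "eta0 t s * h0 s x y \<le> ?A * (eta0 t s * weight t s)" for s
  proof (cases "0 < s")
    case True
    let ?\<sigma> = "sqrt s"
    have Vs: "0 < vol x ?\<sigma>" using True by (simp add: vol_pos)
    have "vol x (rad t) \<le> vol x (?\<sigma> + rad t)" using True by (intro vol_mono_radius) simp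
    also have "\<dots> \<le> D * ((?\<sigma> + rad t) / ?\<sigma>) powr growth * vol x ?\<sigma>"
      using True rad_pos[OF t] by (intro vol_growth) auto
    also have "(?\<sigma> + rad t) / ?\<sigma> = 1 + rad t / ?\<sigma>" using True by (simp add: field_simps)
    finally have "1 / vol x ?\<sigma> \<le> D * weight t s / vol x (rad t)"
      using V Vs by (simp add: weight_def field_simps)
    then have a: "c2 * (1 / vol x ?\<sigma>) \<le> c2 * (D * weight t s / vol x (rad t))"
      using c2_pos by (intro mult_left_mono) auto
    have "h s x y \<le> c2 / vol x ?\<sigma> * exp (- C * (dist x y)\<^sup>2 / s)" by (rule h_upper[OF True])
    also have "\<dots> \<le> c2 / vol x ?\<sigma> * 1"
      using c2_pos C_pos Vs True by (intro mult_left_mono) auto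
    also have "\<dots> \<le> ?A * weight t s" using a by simp
    finally have "eta0 t s * h s x y \<le> eta0 t s * (?A * weight t s)"
      by (rule mult_left_mono) (rule eta0_nonneg)
    then show ?thesis using True by (simp add: h0_def mult_ac)
  qed (simp add: eta0_def)
  then have "(\<integral>\<^sup>+s. ennreal (eta0 t s * h0 s x y) \<partial>lborel)
      \<le> (\<integral>\<^sup>+s. ennreal ?A * ennreal (eta0 t s * weight t s) \<partial>lborel)"
    using V c2_pos D_ge by (intro nn_integral_mono)
      (simp add: ennreal_mult[symmetric] eta0_nonneg weight_nonneg ennreal_leI del: times_divide_eq_left)
  also have "\<dots> = ennreal ?A * (\<integral>\<^sup>+s. ennreal (eta0 t s * weight t s) \<partial>lborel)"
    by (rule nn_integral_cmult) measurable
  also have "\<dots> < \<infinity>"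
    using J by (simp add: ennreal_mult_less_top le_less_trans[OF _ ennreal_less_top])
  finally show ?thesis .
qed

lemma ennreal_frac_kernel:
  assumes t: "0 < t"
  shows "ennreal (frac_kernel \<eta> h t x y) = (\<integral>\<^sup>+s. ennreal (eta0 t s * h0 s x y) \<partial>lborel)"
proof -
  have "integrable lborel (\<lambda>s. eta0 t s * h0 s x y)"
    using nn_integral_kernel_finite[OF t] by (intro integrableI_nonneg) (auto simp: eta0_h0_nonneg)
  then show ?thesis
    by (simp add: frac_kernel_eq[OF t] nn_integral_eq_integral eta0_h0_nonneg)
qed

text \<open>
  The extension is non-tangentially dominated by the maximal function: the point \<open>y\<close> is
  allowed anywhere in the ball of radius \<open>rad t\<close> about \<open>x\<close>.
\<close>

lemma frac_kernel_average_le: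
  "\<exists>M>0. \<forall>F\<in>borel_measurable \<mu>. \<forall>t>0. \<forall>x y. \<forall>l\<ge>0.
     y \<notin> maximal_set F l \<longrightarrow> y \<in> ball x (rad t) \<longrightarrow>
     (\<integral>\<^sup>+z. ennreal (frac_kernel \<eta> h t x z) * F z \<partial>\<mu>) \<le> ennreal (M * l)"
proof -
  obtain J where J: "0 < J" "\<And>t. 0 < t \<Longrightarrow> (\<integral>\<^sup>+s. ennreal (eta0 t s * weight t s) \<partial>lborel) \<le> ennreal J"
    using weight_moment_bound by blast
  interpret P: pair_sigma_finite lborel \<mu> ..
  have "(\<integral>\<^sup>+z. ennreal (frac_kernel \<eta> h t x z) * F z \<partial>\<mu>) \<le> ennreal (heat_const * J * l)"
    if [measurable]: "F \<in> borel_measurable \<mu>" and t: "0 < t" and l: "0 \<le> l"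
      and y: "y \<notin> maximal_set F l" "y \<in> ball x (rad t)" for F t x y l
  proof -
    have "(\<integral>\<^sup>+z. ennreal (frac_kernel \<eta> h t x z) * F z \<partial>\<mu>)
        = (\<integral>\<^sup>+z. (\<integral>\<^sup>+s. ennreal (eta0 t s * h0 s x z) * F z \<partial>lborel) \<partial>\<mu>)"
      by (simp add: ennreal_frac_kernel[OF t] nn_integral_multc)
    also have "\<dots> = (\<integral>\<^sup>+s. (\<integral>\<^sup>+z. ennreal (eta0 t s * h0 s x z) * F z \<partial>\<mu>) \<partial>lborel)"
      by (rule P.Fubini') measurable
    also have "\<dots> \<le> (\<integral>\<^sup>+s. ennreal (heat_const * l) * ennreal (eta0 t s * weight t s) \<partial>lborel)"
    proof (intro nn_integral_mono)
      fix s
      show "(\<integral>\<^sup>+z. ennreal (eta0 t s * h0 s x z) * F z \<partial>\<mu>)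
          \<le> ennreal (heat_const * l) * ennreal (eta0 t s * weight t s)"
      proof (cases "0 < s")
        case True
        have [measurable]: "(\<lambda>z. h s x z) \<in> borel_measurable \<mu>"
          using measurable_compose[OF _ h0_measurable_outer, of "\<lambda>z. (s, z)" \<mu> x] True
          by (simp add: h0_def)
        have "(\<integral>\<^sup>+z. ennreal (eta0 t s * h0 s x z) * F z \<partial>\<mu>)
            = (\<integral>\<^sup>+z. ennreal (eta0 t s) * (ennreal (h s x z) * F z) \<partial>\<mu>)"
          using True by (simp add: h0_def ennreal_mult eta0_nonneg h_nonneg mult.assoc)
        also have "\<dots> = ennreal (eta0 t s) * (\<integral>\<^sup>+z. ennreal (h s x z) * F z \<partial>\<mu>)"
          by (rule nn_integral_cmult) measurable
        also have "\<dots> \<le> ennreal (eta0 t s) * ennreal (heat_const * weight t s * l)"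
          unfolding weight_def
          by (intro mult_left_mono heat_average_le[OF _ True rad_pos[OF t] l y]) auto
        also have "\<dots> = ennreal (heat_const * l) * ennreal (eta0 t s * weight t s)"
          using heat_const_pos l by (simp add: ennreal_mult[symmetric] eta0_nonneg weight_nonneg mult_ac)
        finally show ?thesis .
      qed (simp add: eta0_def)
    qed
    also have "\<dots> = ennreal (heat_const * l) * (\<integral>\<^sup>+s. ennreal (eta0 t s * weight t s) \<partial>lborel)"
      by (rule nn_integral_cmult) measurable
    also have "\<dots> \<le> ennreal (heat_const * l) * ennreal J"
      using J(2)[OF t] by (rule mult_left_mono) simp
    also have "\<dots> = ennreal (heat_const * J * l)"
      using heat_const_pos l J(1) by (simp add: ennreal_mult[symmetric] mult_ac)
    finally show ?thesis .
  qed
  then show ?thesis using heat_const_pos J(1) by (intro exI[of _ "heat_const * J"]) auto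
qed

lemma frac_extension_level_in_maximal_set:
  "\<exists>M>0. \<forall>f\<in>borel_measurable \<mu>. \<forall>t>0. \<forall>x. \<forall>l\<ge>0.
     M * l < \<bar>frac_extension \<mu> \<eta> h f (t, x)\<bar> \<longrightarrow> ball x (rad t) \<subseteq> maximal_set (\<lambda>z. ennreal \<bar>f z\<bar>) l"
proof -
  obtain M where M: "0 < M" "\<And>F t x y l. F \<in> borel_measurable \<mu> \<Longrightarrow> 0 < t \<Longrightarrow> 0 \<le> l \<Longrightarrow>
     y \<notin> maximal_set F l \<Longrightarrow> y \<in> ball x (rad t) \<Longrightarrow>
     (\<integral>\<^sup>+z. ennreal (frac_kernel \<eta> h t x z) * F z \<partial>\<mu>) \<le> ennreal (M * l)"
    using frac_kernel_average_le by blast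
  have "y \<in> maximal_set (\<lambda>z. ennreal \<bar>f z\<bar>) l"
    if [measurable]: "f \<in> borel_measurable \<mu>" and t: "0 < t" and l: "0 \<le> l"
      and less: "M * l < \<bar>frac_extension \<mu> \<eta> h f (t, x)\<bar>" and y: "y \<in> ball x (rad t)" for f t x l y
  proof (rule ccontr)
    assume n: "y \<notin> maximal_set (\<lambda>z. ennreal \<bar>f z\<bar>) l"
    let ?g = "\<lambda>z. frac_kernel \<eta> h t x z * f z"
    have "ennreal \<bar>frac_extension \<mu> \<eta> h f (t, x)\<bar> \<le> (\<integral>\<^sup>+z. ennreal (norm (?g z)) \<partial>\<mu>)"
    proof (cases "integrable \<mu> ?g")
      case True
      then show ?thesis
        using integral_norm_bound_ennreal[OF True] by (simp add: frac_extension_def)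
    qed (simp add: frac_extension_def not_integrable_integral_eq)
    also have "\<dots> = (\<integral>\<^sup>+z. ennreal (frac_kernel \<eta> h t x z) * ennreal \<bar>f z\<bar> \<partial>\<mu>)"
      by (simp add: abs_mult ennreal_mult frac_kernel_nonneg[OF t])
    also have "\<dots> \<le> ennreal (M * l)"
      by (rule M(2)[OF _ t l n y]) measurable
    finally show False using less M(1) l by (simp add: ennreal_le_iff)
  qed
  then show ?thesis using M(1) by (intro exI[of _ M]) blast
qed

text \<open>
  The time window \<open>(rad t)\<^sup>2 \<le> s \<le> 2 (rad t)\<^sup>2\<close> carries enough of the subordination integral: there
  the density is at least a multiple of \<open>(rad t)\<^bsup>-2\<^esup>\<close>, and the Gaussian factor is bounded below.
\<close>

lemma frac_kernel_lower:
  "\<exists>\<kappa>>0. \<forall>t>0. \<forall>x y. dist x y < rad t \<longrightarrow> \<kappa> / vol x (rad t) \<le> frac_kernel \<eta> h t x y"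
proof -
  have "\<exists>e1>0. \<exists>e2>0. \<forall>t>0. \<forall>s\<ge>t powr (1 / \<alpha>).
        e1 * (t / s powr (1 + \<alpha>)) \<le> \<eta> t s \<and> \<eta> t s \<le> e2 * (t / s powr (1 + \<alpha>))"
    using density unfolding subordination_density_def by (elim conjE) assumption
  then obtain e where e: "0 < e" "\<And>t s. 0 < t \<Longrightarrow> t powr (1 / \<alpha>) \<le> s \<Longrightarrow> e * (t / s powr (1 + \<alpha>)) \<le> \<eta> t s"
    by blast
  define \<kappa> where "\<kappa> = e * 2 powr (- (1 + \<alpha>)) * (c1 * exp (- C) / D)"
  have kpos: "0 < \<kappa>" using e(1) c1_pos D_ge by (simp add: \<kappa>_def)
  have "\<kappa> / vol x (rad t) \<le> frac_kernel \<eta> h t x y" if t: "0 < t" and d: "dist x y < rad t" for t x y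
  proof -
    define a where "a = t powr (1 / \<alpha>)"
    have a: "0 < a" using t by (simp add: a_def)
    have ra: "(rad t)\<^sup>2 = a" by (simp add: rad_square[OF t] a_def)
    have V: "0 < vol x (rad t)" using rad_pos[OF t] by (rule vol_pos)
    have ta: "t = a powr \<alpha>" using t alpha by (simp add: a_def powr_powr)
    have low: "\<kappa> / (a * vol x (rad t)) \<le> eta0 t s * h0 s x y" if s: "s \<in> {a..2 * a}" for s
    proof -
      have s0: "0 < s" using s a by auto
      have "e * 2 powr (- (1 + \<alpha>)) / a = e * (t / (2 * a) powr (1 + \<alpha>))"
      proof -
        have "(2 * a) powr (1 + \<alpha>) = 2 powr (1 + \<alpha>) * (a * a powr \<alpha>)"
          using a by (simp add: powr_mult powr_add)
        then show ?thesis
          using a by (simp only: ta powr_minus_divide) simp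
      qed
      also have "\<dots> \<le> e * (t / s powr (1 + \<alpha>))"
        using s a e(1) t alpha s0 by (intro mult_left_mono divide_left_mono powr_mono2 mult_pos_pos) auto
      also have "\<dots> \<le> \<eta> t s" using s t by (intro e(2)) (auto simp: a_def)
      finally have 1: "e * 2 powr (- (1 + \<alpha>)) / a \<le> eta0 t s" using t s0 by (simp add: eta0_def)
      have "sqrt s \<le> 2 * rad t"
      proof (rule real_le_lsqrt)
        have "s \<le> 4 * a" using s a by auto
        then show "s \<le> (2 * rad t)\<^sup>2" by (simp add: power_mult_distrib ra)
      qed (use rad_pos[OF t] in simp)
      then have "vol x (sqrt s) \<le> vol x (2 * rad t)" by (rule vol_mono_radius)
      also have "\<dots> \<le> D * vol x (rad t)" by (rule vol_double[OF rad_pos[OF t]])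
      finally have v: "vol x (sqrt s) \<le> D * vol x (rad t)" .
      have vs: "0 < vol x (sqrt s)" using s0 by (simp add: vol_pos)
      have "(dist x y)\<^sup>2 \<le> (rad t)\<^sup>2" using d by (intro power_mono) auto
      then have "(dist x y)\<^sup>2 \<le> s" using s ra by simp
      then have "C * (dist x y)\<^sup>2 / s \<le> C" using C_pos s0 by (simp add: field_simps)
      then have "exp (- C) \<le> exp (- C * (dist x y)\<^sup>2 / s)" by simp
      then have "c1 / (D * vol x (rad t)) * exp (- C) \<le> c1 / vol x (sqrt s) * exp (- C * (dist x y)\<^sup>2 / s)"
        using c1_pos v vs V D_ge by (intro mult_mono divide_left_mono mult_pos_pos) auto
      also have "\<dots> \<le> h s x y" by (rule h_lower[OF s0])
      finally have 2: "c1 * exp (- C) / D / vol x (rad t) \<le> h0 s x y" using s0 by (simp add: h0_def)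
      have "\<kappa> / (a * vol x (rad t)) = e * 2 powr (- (1 + \<alpha>)) / a * (c1 * exp (- C) / D / vol x (rad t))"
        by (simp add: \<kappa>_def)
      also have "\<dots> \<le> eta0 t s * h0 s x y"
        using 1 2 e(1) a c1_pos D_ge V by (intro mult_mono eta0_nonneg) auto
      finally show ?thesis .
    qed
    have "ennreal (\<kappa> / vol x (rad t)) = ennreal (\<kappa> / (a * vol x (rad t))) * emeasure lborel {a..2 * a}"
      using a kpos V by (simp add: ennreal_mult[symmetric])
    also have "\<dots> = (\<integral>\<^sup>+s. ennreal (\<kappa> / (a * vol x (rad t))) * indicator {a..2 * a} s \<partial>lborel)"
      by (simp add: nn_integral_cmult_indicator)
    also have "\<dots> \<le> (\<integral>\<^sup>+s. ennreal (eta0 t s * h0 s x y) \<partial>lborel)"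
      using low by (intro nn_integral_mono) (auto split: split_indicator intro: ennreal_leI)
    finally show ?thesis
      by (simp add: ennreal_frac_kernel[OF t, symmetric] ennreal_le_iff frac_kernel_nonneg[OF t])
  qed
  then show ?thesis using kpos by blast
qed

lemma frac_extension_indicator_lower:
  "\<exists>\<kappa>>0. \<forall>S\<in>sets \<mu>. \<forall>t>0. \<forall>x. ball x (rad t) \<subseteq> S \<longrightarrow>
     \<kappa> \<le> frac_extension \<mu> \<eta> h (indicat_real S) (t, x)"
proof -
  obtain \<kappa> where k: "0 < \<kappa>" "\<And>t x y. 0 < t \<Longrightarrow> dist x y < rad t \<Longrightarrow> \<kappa> / vol x (rad t) \<le> frac_kernel \<eta> h t x y"
    using frac_kernel_lower by blast
  obtain M where M: "0 < M" "\<And>F t x y l. F \<in> borel_measurable \<mu> \<Longrightarrow> 0 < t \<Longrightarrow> 0 \<le> l \<Longrightarrow>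
     y \<notin> maximal_set F l \<Longrightarrow> y \<in> ball x (rad t) \<Longrightarrow>
     (\<integral>\<^sup>+z. ennreal (frac_kernel \<eta> h t x z) * F z \<partial>\<mu>) \<le> ennreal (M * l)"
    using frac_kernel_average_le by blast
  have "\<kappa> \<le> frac_extension \<mu> \<eta> h (indicat_real S) (t, x)"
    if S [measurable]: "S \<in> sets \<mu>" and t: "0 < t" and sub: "ball x (rad t) \<subseteq> S" for S t x
  proof -
    have [measurable]: "frac_kernel \<eta> h t x \<in> borel_measurable \<mu>"
      by (rule frac_kernel_measurable_right[OF t])
    have V: "0 < vol x (rad t)" using rad_pos[OF t] by (rule vol_pos)
    have "maximal_set (\<lambda>_. 1) 1 = {}" by (simp add: maximal_set_def)
    then have "(\<integral>\<^sup>+z. ennreal (frac_kernel \<eta> h t x z) * 1 \<partial>\<mu>) \<le> ennreal (M * 1)"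
      by (intro M(2)[OF _ t, where y = x]) (auto simp: rad_pos[OF t])
    then have "integrable \<mu> (frac_kernel \<eta> h t x)"
      by (intro integrableI_nonneg)
         (auto simp: frac_kernel_nonneg[OF t] intro: le_less_trans[OF _ ennreal_less_top])
    then have int: "integrable \<mu> (\<lambda>y. frac_kernel \<eta> h t x y * indicat_real S y)"
      using integrable_mult_indicator[OF S, of "frac_kernel \<eta> h t x"] by (simp add: mult.commute)
    have "\<kappa> = (LINT y|\<mu>. \<kappa> / vol x (rad t) * indicat_real (ball x (rad t)) y)"
      using V by (simp add: space_UNIV vol_def)
    also have "\<dots> \<le> (LINT y|\<mu>. frac_kernel \<eta> h t x y * indicat_real S y)"
    proof (rule integral_mono[OF _ int])
      show "integrable \<mu> (\<lambda>y. \<kappa> / vol x (rad t) * indicat_real (ball x (rad t)) y)"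
        using ball_finite[of x "rad t"] by (intro integrable_mult_right integrable_real_indicator) auto
      show "\<kappa> / vol x (rad t) * indicat_real (ball x (rad t)) y \<le> frac_kernel \<eta> h t x y * indicat_real S y" for y
        using k(2)[OF t, of x y] sub frac_kernel_nonneg[OF t, of x y] by (auto split: split_indicator)
    qed
    finally show ?thesis by (simp add: frac_extension_def)
  qed
  then show ?thesis using k(1) by blast
qed

end

section \<open>Radon measures on the upper half-space\<close>

lemma radon_space: "radon_measure_on upper_half \<nu> \<Longrightarrow> space \<nu> = upper_half"
  unfolding radon_measure_on_def using sets_eq_imp_space_eq[of \<nu>] by (simp add: space_restrict_space)

lemma radon_compact_finite:
  "radon_measure_on S \<nu> \<Longrightarrow> compact K \<Longrightarrow> K \<subseteq> S \<Longrightarrow> emeasure \<nu> K < \<infinity>"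
  unfolding radon_measure_on_def by simp

lemma radon_inner_regular:
  "radon_measure_on S \<nu> \<Longrightarrow> A \<in> sets \<nu> \<Longrightarrow> emeasure \<nu> A = (SUP K\<in>{K. compact K \<and> K \<subseteq> A}. emeasure \<nu> K)"
  unfolding radon_measure_on_def by simp

lemma borel_in_radon_sets:
  fixes \<nu> :: "(real \<times> 'a::topological_space) measure"
  assumes "radon_measure_on upper_half \<nu>" "A \<in> sets borel" "A \<subseteq> upper_half"
  shows "A \<in> sets \<nu>"
  using assms unfolding radon_measure_on_def
  by (auto simp: sets_restrict_space intro!: image_eqI[of _ _ A])

lemma parabolic_ball_sets:
  fixes \<nu> :: "(real \<times> 'a::metric_space) measure"
  assumes "radon_measure_on upper_half \<nu>"
  shows "parabolic_ball \<alpha> r t0 x0 \<in> sets \<nu>"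
proof (rule borel_in_radon_sets[OF assms])
  have "parabolic_ball \<alpha> r t0 x0 = {z. 0 < fst z \<and> r powr (2 * \<alpha>) < fst z - t0 \<and>
      fst z - t0 < 2 * r powr (2 * \<alpha>) \<and> dist (snd z) x0 < r}"
    unfolding parabolic_ball_def upper_half_def by auto
  also have "open \<dots>"
    by (intro open_Collect_conj open_Collect_less continuous_intros)
  finally show "parabolic_ball \<alpha> r t0 x0 \<in> sets borel" by simp
qed (auto simp: parabolic_ball_def)

section \<open>Shadows and the Carleson embedding\<close>

context frac_heat
begin

definition shadow :: "(real \<times> 'a) set \<Rightarrow> 'a set" where
  "shadow K = (\<Union>(t, x)\<in>K. ball x (rad t))"

lemma open_shadow: "open (shadow K)"
  unfolding shadow_def by (intro open_UN) auto

lemma rad_mono: "0 \<le> s \<Longrightarrow> s \<le> t \<Longrightarrow> rad s \<le> rad t"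
  unfolding rad_def using alpha by (intro powr_mono2) auto

lemma emeasure_shadow_finite:
  assumes "compact K" "K \<subseteq> upper_half"
  shows "emeasure \<mu> (shadow K) < \<infinity>"
proof (rule emeasure_bounded_finite)
  have "bounded (fst ` K)" "bounded (snd ` K)"
    using assms(1) by (intro compact_imp_bounded compact_continuous_image continuous_intros; assumption)+
  then obtain T a R where T: "\<forall>t\<in>fst ` K. norm t \<le> T" and R: "\<forall>x\<in>snd ` K. dist a x \<le> R"
    by (auto simp: bounded_iff[of "fst ` K"] bounded_def[of "snd ` K"])
  have "dist a y \<le> R + rad T" if y: "y \<in> shadow K" for y
  proof -
    obtain t x where tx: "(t, x) \<in> K" "dist x y < rad t" using y by (auto simp: shadow_def)
    have "0 < t" using tx(1) assms(2) by (auto simp: upper_half_def)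
    moreover have "t \<le> T" using T tx(1) \<open>0 < t\<close> by force
    ultimately have "rad t \<le> rad T" by (intro rad_mono) auto
    moreover have "dist a x \<le> R" using R tx(1) by force
    ultimately show ?thesis using tx(2) dist_triangle[of a y x] by simp
  qed
  then show "bounded (shadow K)" unfolding bounded_def by blast
qed

text \<open>
  If a compact set lies in the level set \<open>\<bar>T f\<bar> > 2\<^sup>k\<close> of the extension, then its shadow lies in a
  level set of the maximal function. So the dyadic layers of \<open>T f\<close> are estimated by those of
  the maximal function, and the maximal inequality sums them.
\<close>

lemma bounded_if_shadow_condition:
  assumes \<nu>: "radon_measure_on upper_half \<nu>" and pq: "1 < p" "p \<le> q" and A: "0 < A"
    and shadow: "\<And>K. compact K \<Longrightarrow> K \<subseteq> upper_half \<Longrightarrow>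
        emeasure \<nu> K \<le> ennreal (A * measure \<mu> (shadow K) powr (q / p))"
  shows "Lp_Lq_bounded \<mu> p \<nu> q (frac_extension \<mu> \<eta> h)"
proof -
  let ?T = "frac_extension \<mu> \<eta> h"
  obtain M where M: "0 < M" "\<And>f t x l. f \<in> borel_measurable \<mu> \<Longrightarrow> 0 < t \<Longrightarrow> 0 \<le> l \<Longrightarrow>
      M * l < \<bar>?T f (t, x)\<bar> \<Longrightarrow> ball x (rad t) \<subseteq> maximal_set (\<lambda>z. ennreal \<bar>f z\<bar>) l"
    using frac_extension_level_in_maximal_set by blast
  define G where "G = D\<^sup>2 * (2 * M) powr p / (1 - 2 powr (1 - p))"
  have G: "0 < G"
  proof -
    have "2 powr (1 - p) < 1" using pq by (simp add: powr_less_one)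
    then show ?thesis using M(1) D_ge by (simp add: G_def)
  qed
  define B where "B = (2 powr q * A * G powr (q / p)) powr (1 / q)"
  have "?T f \<in> Lp_space \<nu> q \<and> Lp_norm \<nu> q (?T f) \<le> B * Lp_norm \<mu> p f" if f: "f \<in> Lp_space \<mu> p" for f
  proof -
    have [measurable]: "f \<in> borel_measurable \<mu>" using f by (simp add: Lp_space_def)
    define I where "I = (\<integral>\<^sup>+z. ennreal (\<bar>f z\<bar> powr p) \<partial>\<mu>)"
    have Ifin: "I < \<infinity>" using f by (simp add: Lp_space_def I_def)
    then have I: "I = ennreal (enn2real I)" by simp
    define W where "W k = maximal_set (\<lambda>z. ennreal \<bar>f z\<bar>) (2 powr real_of_int k / M)" for k :: int
    have strong: "(\<integral>\<^sup>+k. ennreal (2 powr (real_of_int k * p)) * emeasure \<mu> (W k) \<partial>count_space UNIV) \<le> ennreal (G * enn2real I)"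
    proof -
      have "(\<integral>\<^sup>+k. ennreal (2 powr (real_of_int k * p)) * emeasure \<mu> (W k) \<partial>count_space UNIV) \<le> ennreal G * I"
        unfolding W_def G_def I_def using pq M(1) by (intro dyadic_maximal_strong_type) auto
      also have "ennreal G * I = ennreal (G * enn2real I)"
        by (subst I) (use G in \<open>simp add: ennreal_mult\<close>)
      finally show ?thesis .
    qed
    have Wfin: "emeasure \<mu> (W k) < \<infinity>" for k
    proof -
      have "ennreal (2 powr (real_of_int k * p)) * emeasure \<mu> (W k) \<le> ennreal (G * enn2real I)"
        using nn_integral_ge_point[of k UNIV "\<lambda>k. ennreal (2 powr (real_of_int k * p)) * emeasure \<mu> (W k)"] strong
        by (simp add: order_trans)
      then have "ennreal (2 powr (real_of_int k * p)) * emeasure \<mu> (W k) < \<infinity>"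
        by (rule le_less_trans) simp
      then show ?thesis by (auto simp: ennreal_mult_less_top)
    qed
    have Tm [measurable]: "?T f \<in> borel_measurable \<nu>"
      using \<nu> by (intro frac_extension_measurable) (auto simp: radon_measure_on_def)
    define E where "E k = {z \<in> space \<nu>. 2 powr real_of_int k < \<bar>?T f z\<bar>}" for k :: int
    have Es: "E k \<in> sets \<nu>" for k unfolding E_def by measurable
    have E: "emeasure \<nu> (E k) \<le> ennreal (A * measure \<mu> (W k) powr (q / p))" for k
    proof -
      have "emeasure \<nu> K \<le> ennreal (A * measure \<mu> (W k) powr (q / p))" if K: "compact K" "K \<subseteq> E k" for K
      proof -
        have Ku: "K \<subseteq> upper_half" using K(2) by (auto simp: E_def radon_space[OF \<nu>])
        have "shadow K \<subseteq> W k"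
        proof -
          have "ball x (rad t) \<subseteq> W k" if "(t, x) \<in> K" for t x
            unfolding W_def using that K(2) Ku M(1)
            by (intro M(2)) (auto simp: E_def upper_half_def)
          then show ?thesis by (auto simp: shadow_def)
        qed
        then have "measure \<mu> (shadow K) \<le> measure \<mu> (W k)"
          using Wfin[of k] by (intro measure_mono_fmeasurable fmeasurableI)
            (auto simp: open_sets open_shadow W_def open_maximal_set)
        then have "ennreal (A * measure \<mu> (shadow K) powr (q / p)) \<le> ennreal (A * measure \<mu> (W k) powr (q / p))"
          using A pq by (intro ennreal_leI mult_left_mono powr_mono2) auto
        then show ?thesis using shadow[OF K(1) Ku] by simp
      qed
      then show ?thesis
        by (subst radon_inner_regular[OF \<nu> Es]) (auto intro: SUP_least)
    qed
    let ?m = "\<lambda>k. 2 powr (real_of_int k * p) * measure \<mu> (W k)"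
    have "(\<integral>\<^sup>+z. ennreal (\<bar>?T f z\<bar> powr q) \<partial>\<nu>)
        \<le> (\<integral>\<^sup>+z. (\<integral>\<^sup>+k. ennreal (2 powr ((real_of_int k + 1) * q)) *
              indicator {k. 2 powr real_of_int k < \<bar>?T f z\<bar>} k \<partial>count_space UNIV) \<partial>\<nu>)"
      using pq by (intro nn_integral_mono powr_le_dyadic_sum) auto
    also have "\<dots> = (\<integral>\<^sup>+k. (\<integral>\<^sup>+z. ennreal (2 powr ((real_of_int k + 1) * q)) *
              indicator {k. 2 powr real_of_int k < \<bar>?T f z\<bar>} k \<partial>\<nu>) \<partial>count_space UNIV)"
      by (intro nn_integral_count_space_nn_integral) (simp_all add: indicator_def)
    also have "\<dots> = (\<integral>\<^sup>+k. ennreal (2 powr ((real_of_int k + 1) * q)) * emeasure \<nu> (E k) \<partial>count_space UNIV)"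
    proof (intro nn_integral_cong)
      fix k :: int
      have "(\<integral>\<^sup>+z. ennreal (2 powr ((real_of_int k + 1) * q)) * indicator {k. 2 powr real_of_int k < \<bar>?T f z\<bar>} k \<partial>\<nu>)
          = (\<integral>\<^sup>+z. ennreal (2 powr ((real_of_int k + 1) * q)) * indicator (E k) z \<partial>\<nu>)"
        by (intro nn_integral_cong) (auto simp: E_def split: split_indicator)
      also have "\<dots> = ennreal (2 powr ((real_of_int k + 1) * q)) * emeasure \<nu> (E k)"
        by (rule nn_integral_cmult_indicator[OF Es])
      finally show "(\<integral>\<^sup>+z. ennreal (2 powr ((real_of_int k + 1) * q)) * indicator {k. 2 powr real_of_int k < \<bar>?T f z\<bar>} k \<partial>\<nu>)
          = ennreal (2 powr ((real_of_int k + 1) * q)) * emeasure \<nu> (E k)" .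
    qed
    also have "\<dots> \<le> (\<integral>\<^sup>+k. ennreal (2 powr q * A) * ennreal (?m k powr (q / p)) \<partial>count_space UNIV)"
    proof (intro nn_integral_mono)
      fix k :: int
      have "ennreal (2 powr ((real_of_int k + 1) * q)) * emeasure \<nu> (E k)
          \<le> ennreal (2 powr ((real_of_int k + 1) * q)) * ennreal (A * measure \<mu> (W k) powr (q / p))"
        by (intro mult_left_mono E) simp
      also have "\<dots> = ennreal (2 powr q * A * (?m k powr (q / p)))"
      proof -
        have "2 powr ((real_of_int k + 1) * q) = 2 powr q * 2 powr (real_of_int k * q)"
          by (simp add: distrib_right powr_add)
        then show ?thesis
          using A pq by (simp add: ennreal_mult[symmetric] powr_mult powr_powr mult_ac)
      qed
      also have "\<dots> = ennreal (2 powr q * A) * ennreal (?m k powr (q / p))"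
        using A by (intro ennreal_mult) auto
      finally show "ennreal (2 powr ((real_of_int k + 1) * q)) * emeasure \<nu> (E k)
          \<le> ennreal (2 powr q * A) * ennreal (?m k powr (q / p))" .
    qed
    also have "\<dots> = ennreal (2 powr q * A) * (\<integral>\<^sup>+k. ennreal (?m k powr (q / p)) \<partial>count_space UNIV)"
      by (rule nn_integral_cmult) simp
    also have "\<dots> \<le> ennreal (2 powr q * A) * ennreal ((G * enn2real I) powr (q / p))"
    proof (intro mult_left_mono sum_powr_le_powr_sum)
      have "(\<integral>\<^sup>+k. ennreal (?m k) \<partial>count_space UNIV)
          = (\<integral>\<^sup>+k. ennreal (2 powr (real_of_int k * p)) * emeasure \<mu> (W k) \<partial>count_space UNIV)"
      proof (intro nn_integral_cong)
        fix k :: int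
        show "ennreal (?m k) = ennreal (2 powr (real_of_int k * p)) * emeasure \<mu> (W k)"
          using Wfin[of k] by (simp add: ennreal_mult emeasure_eq_ennreal_measure)
      qed
      then show "(\<integral>\<^sup>+k. ennreal (?m k) \<partial>count_space UNIV) \<le> ennreal (G * enn2real I)"
        using strong by simp
    qed (use pq G in auto)
    also have "\<dots> = ennreal (2 powr q * A * (G * enn2real I) powr (q / p))"
      using A by (intro ennreal_mult[symmetric]) auto
    finally have main: "(\<integral>\<^sup>+z. ennreal (\<bar>?T f z\<bar> powr q) \<partial>\<nu>)
        \<le> ennreal (2 powr q * A * (G * enn2real I) powr (q / p))" .
    have "?T f \<in> Lp_space \<nu> q"
      using le_less_trans[OF main] Tm by (simp add: Lp_space_def)
    moreover have "Lp_norm \<nu> q (?T f) \<le> B * Lp_norm \<mu> p f"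
    proof -
      have "enn2real (\<integral>\<^sup>+z. ennreal (\<bar>?T f z\<bar> powr q) \<partial>\<nu>) \<le> 2 powr q * A * (G * enn2real I) powr (q / p)"
        using enn2real_mono[OF main] A by simp
      then have "Lp_norm \<nu> q (?T f) \<le> (2 powr q * A * (G * enn2real I) powr (q / p)) powr (1 / q)"
        unfolding Lp_norm_def using pq by (intro powr_mono2) auto
      also have "\<dots> = B * (enn2real I powr (q / p)) powr (1 / q)"
        using A G by (simp add: B_def powr_mult mult_ac)
      also have "\<dots> = B * Lp_norm \<mu> p f"
        using pq by (simp add: powr_powr Lp_norm_def I_def)
      finally show ?thesis .
    qed
    ultimately show ?thesis by blast
  qed
  moreover have "0 \<le> B" by (simp add: B_def)
  ultimately show ?thesis unfolding Lp_Lq_bounded_def by blast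
qed

text \<open>A multiple of the indicator of the shadow is admissible for the capacity.\<close>

lemma capacity_le_shadow:
  assumes "1 < p"
  shows "\<exists>B>0. \<forall>K. compact K \<longrightarrow> K \<subseteq> upper_half \<longrightarrow>
    frac_capacity \<mu> \<eta> h p K \<le> ennreal (B * measure \<mu> (shadow K))"
proof -
  obtain \<kappa> where k: "0 < \<kappa>" "\<And>S t x. S \<in> sets \<mu> \<Longrightarrow> 0 < t \<Longrightarrow> ball x (rad t) \<subseteq> S \<Longrightarrow>
      \<kappa> \<le> frac_extension \<mu> \<eta> h (indicat_real S) (t, x)"
    using frac_extension_indicator_lower by blast
  have "frac_capacity \<mu> \<eta> h p K \<le> ennreal ((1 / \<kappa>) powr p * measure \<mu> (shadow K))"
    if K: "compact K" "K \<subseteq> upper_half" for K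
  proof -
    let ?S = "shadow K"
    let ?f = "\<lambda>y. 1 / \<kappa> * indicat_real ?S y"
    have S [measurable]: "?S \<in> sets \<mu>" by (simp add: open_sets open_shadow)
    have fin: "emeasure \<mu> ?S < \<infinity>" by (rule emeasure_shadow_finite[OF K])
    have "(\<integral>\<^sup>+y. ennreal (\<bar>?f y\<bar> powr p) \<partial>\<mu>) = (\<integral>\<^sup>+y. ennreal ((1 / \<kappa>) powr p) * indicator ?S y \<partial>\<mu>)"
      using k(1) assms by (intro nn_integral_cong) (auto split: split_indicator)
    also have "\<dots> = ennreal ((1 / \<kappa>) powr p) * emeasure \<mu> ?S"
      by (rule nn_integral_cmult_indicator[OF S])
    also have "\<dots> = ennreal ((1 / \<kappa>) powr p * measure \<mu> ?S)"
      using fin by (simp add: emeasure_eq_ennreal_measure ennreal_mult)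
    finally have I: "(\<integral>\<^sup>+y. ennreal (\<bar>?f y\<bar> powr p) \<partial>\<mu>) = ennreal ((1 / \<kappa>) powr p * measure \<mu> ?S)" .
    have norm: "Lp_norm \<mu> p ?f powr p = (1 / \<kappa>) powr p * measure \<mu> ?S"
      using assms by (simp only: Lp_norm_def I) (simp add: powr_powr)
    have ext: "frac_extension \<mu> \<eta> h ?f z = 1 / \<kappa> * frac_extension \<mu> \<eta> h (indicat_real ?S) z" for z
    proof -
      have "(LINT y|\<mu>. frac_kernel \<eta> h t x y * (1 / \<kappa> * indicat_real ?S y))
          = (LINT y|\<mu>. 1 / \<kappa> * (frac_kernel \<eta> h t x y * indicat_real ?S y))" for t x
        by (simp add: mult_ac)
      then show ?thesis by (simp add: frac_extension_def split: prod.split)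
    qed
    have "indicat_real K z \<le> frac_extension \<mu> \<eta> h ?f z" if z: "z \<in> upper_half" for z
    proof (cases "z \<in> K")
      case True
      obtain t x where tx: "z = (t, x)" "0 < t" using z by (cases z) (auto simp: upper_half_def)
      have "\<kappa> \<le> frac_extension \<mu> \<eta> h (indicat_real ?S) (t, x)"
        using True tx(1) by (intro k(2)[OF S tx(2)]) (auto simp: shadow_def)
      then show ?thesis using True k(1) by (simp only: ext tx) (simp add: field_simps)
    next
      case False
      obtain t x where tx: "z = (t, x)" "0 < t" using z by (cases z) (auto simp: upper_half_def)
      have "0 \<le> frac_extension \<mu> \<eta> h (indicat_real ?S) z"
        by (simp add: frac_extension_def tx frac_kernel_nonneg)
      then show ?thesis using False k(1) by (simp only: ext) simp
    qed
    moreover have "?f \<in> Lp_space \<mu> p" by (simp only: Lp_space_def mem_Collect_eq I) simp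
    moreover have "\<forall>y. 0 \<le> ?f y" using k(1) by simp
    ultimately have "frac_capacity \<mu> \<eta> h p K \<le> ennreal (Lp_norm \<mu> p ?f powr p)"
      unfolding frac_capacity_def by (intro INF_lower) blast
    then show ?thesis by (simp only: norm)
  qed
  then show ?thesis using k(1) by (intro exI[of _ "(1 / \<kappa>) powr p"]) auto
qed

lemma bounded_if_capacity_condition:
  assumes \<nu>: "radon_measure_on upper_half \<nu>" and pq: "1 < p" "p \<le> q" and A: "0 < A"
    and cap: "\<And>l. 0 < l \<Longrightarrow> ennreal (l powr (p / q)) \<le> ennreal A * capacity_minimizing \<mu> \<eta> h p \<nu> l"
  shows "Lp_Lq_bounded \<mu> p \<nu> q (frac_extension \<mu> \<eta> h)"
proof -
  obtain B where B: "0 < B" "\<And>K. compact K \<Longrightarrow> K \<subseteq> upper_half \<Longrightarrow>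
      frac_capacity \<mu> \<eta> h p K \<le> ennreal (B * measure \<mu> (shadow K))"
    using capacity_le_shadow[OF pq(1)] by blast
  have "emeasure \<nu> K \<le> ennreal ((A * B) powr (q / p) * measure \<mu> (shadow K) powr (q / p))"
    if K: "compact K" "K \<subseteq> upper_half" for K
  proof -
    define v where "v = enn2real (emeasure \<nu> K)"
    have v: "emeasure \<nu> K = ennreal v" "0 \<le> v"
      using radon_compact_finite[OF \<nu> K] by (simp_all add: v_def)
    show ?thesis
    proof (cases "v = 0")
      case False
      then have v0: "0 < v" using v(2) by simp
      have "ennreal (v powr (p / q)) \<le> ennreal A * capacity_minimizing \<mu> \<eta> h p \<nu> v" by (rule cap[OF v0])
      also have "capacity_minimizing \<mu> \<eta> h p \<nu> v \<le> frac_capacity \<mu> \<eta> h p K"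
        unfolding capacity_minimizing_def using K v by (intro INF_lower) simp
      also have "\<dots> \<le> ennreal (B * measure \<mu> (shadow K))" by (rule B(2)[OF K])
      finally have "ennreal (v powr (p / q)) \<le> ennreal (A * B * measure \<mu> (shadow K))"
        using A B(1) by (simp add: ennreal_mult[symmetric] mult_left_mono mult.assoc)
      then have "v powr (p / q) \<le> A * B * measure \<mu> (shadow K)"
        using A B(1) by (subst (asm) ennreal_le_iff) auto
      then have "(v powr (p / q)) powr (q / p) \<le> (A * B * measure \<mu> (shadow K)) powr (q / p)"
        using pq by (intro powr_mono2) auto
      then have "v \<le> (A * B) powr (q / p) * measure \<mu> (shadow K) powr (q / p)"
        using pq v0 A B(1) by (simp add: powr_powr powr_mult)
      then show ?thesis by (simp add: v ennreal_leI)
    qed (simp add: v)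
  qed
  then show ?thesis using A B(1)
    by (intro bounded_if_shadow_condition[OF \<nu> pq, of "(A * B) powr (q / p)"]) auto
qed

end

text \<open>
  A function admissible for the capacity of \<open>K\<close> has an extension of at least one on \<open>K\<close>, so the
  norm inequality bounds \<open>\<nu>(K)\<close> by a power of its norm.
\<close>

lemma capacity_condition_if_bounded:
  assumes \<nu>: "radon_measure_on upper_half \<nu>" and pq: "1 < p" "p \<le> q"
    and bd: "Lp_Lq_bounded \<mu> p \<nu> q (frac_extension \<mu> \<eta> h)"
  shows "\<exists>A>0. \<forall>l>0. ennreal (l powr (p / q)) \<le> ennreal A * capacity_minimizing \<mu> \<eta> h p \<nu> l"
proof -
  let ?T = "frac_extension \<mu> \<eta> h"
  obtain B where B: "0 \<le> B" "\<And>f. f \<in> Lp_space \<mu> p \<Longrightarrow> ?T f \<in> Lp_space \<nu> q"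
    "\<And>f. f \<in> Lp_space \<mu> p \<Longrightarrow> Lp_norm \<nu> q (?T f) \<le> B * Lp_norm \<mu> p f"
    using bd unfolding Lp_Lq_bounded_def by blast
  define A where "A = (B + 1) powr p"
  have A: "0 < A" using B(1) by (simp add: A_def)
  have "ennreal (l powr (p / q)) \<le> ennreal A * capacity_minimizing \<mu> \<eta> h p \<nu> l" if l: "0 < l" for l
  proof -
    have "ennreal (l powr (p / q) / A) \<le> ennreal (Lp_norm \<mu> p f powr p)"
      if K: "compact K" "K \<subseteq> upper_half" "ennreal l \<le> emeasure \<nu> K"
        and f: "f \<in> Lp_space \<mu> p" "\<And>z. z \<in> upper_half \<Longrightarrow> indicat_real K z \<le> ?T f z" for K f
    proof -
      define I where "I = (\<integral>\<^sup>+z. ennreal (\<bar>?T f z\<bar> powr q) \<partial>\<nu>)"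
      have fin: "I < \<infinity>" using B(2)[OF f(1)] by (simp add: Lp_space_def I_def)
      have Ks: "K \<in> sets \<nu>" using K by (intro borel_in_radon_sets[OF \<nu>] borel_compact)
      have "emeasure \<nu> K = (\<integral>\<^sup>+z. indicator K z \<partial>\<nu>)" using Ks by simp
      also have "\<dots> \<le> I" unfolding I_def
      proof (intro nn_integral_mono)
        fix z
        show "indicator K z \<le> ennreal (\<bar>?T f z\<bar> powr q)"
        proof (cases "z \<in> K")
          case True
          then have "1 \<le> \<bar>?T f z\<bar>" using f(2)[of z] K(2) by auto
          then show ?thesis using pq True by (simp add: ge_one_powr_ge_zero)
        qed simp
      qed
      finally have "ennreal l \<le> ennreal (enn2real I)" using K(3) fin by simp
      then have "l \<le> enn2real I" by simp
      then have "l powr (1 / q) \<le> enn2real I powr (1 / q)" using l pq by (intro powr_mono2) auto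
      also have "\<dots> \<le> B * Lp_norm \<mu> p f" using B(3)[OF f(1)] by (simp add: Lp_norm_def I_def)
      also have "\<dots> \<le> (B + 1) * Lp_norm \<mu> p f" by (intro mult_right_mono) (auto simp: Lp_norm_def)
      finally have "(l powr (1 / q)) powr p \<le> ((B + 1) * Lp_norm \<mu> p f) powr p"
        using pq by (intro powr_mono2) auto
      then have "l powr (p / q) \<le> A * Lp_norm \<mu> p f powr p"
        using B(1) by (simp add: powr_powr A_def powr_mult Lp_norm_def)
      then show ?thesis using A by (intro ennreal_leI) (simp add: field_simps)
    qed
    then have "ennreal (l powr (p / q) / A) \<le> capacity_minimizing \<mu> \<eta> h p \<nu> l"
      unfolding capacity_minimizing_def frac_capacity_def by (intro INF_greatest) blast
    then have "ennreal A * ennreal (l powr (p / q) / A) \<le> ennreal A * capacity_minimizing \<mu> \<eta> h p \<nu> l"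
      by (rule mult_left_mono) simp
    then show ?thesis using A by (simp add: ennreal_mult[symmetric])
  qed
  then show ?thesis using A by blast
qed

section \<open>Parabolic balls\<close>

text \<open>A maximal separated subset; disjointness of the half-size balls bounds its cardinality.\<close>

lemma (in doubling_space) separated_net:
  assumes r: "0 < r" and a: "0 < a" and S: "S \<in> sets \<mu>" "emeasure \<mu> S < \<infinity>"
    and X: "\<And>x. x \<in> X \<Longrightarrow> ball x (r / 2) \<subseteq> S" "\<And>x. x \<in> X \<Longrightarrow> a \<le> vol x (r / 2)"
  shows "\<exists>F\<subseteq>X. finite F \<and> X \<subseteq> (\<Union>x\<in>F. ball x r) \<and> real (card F) * a \<le> measure \<mu> S"
proof -
  define P where "P F \<longleftrightarrow> F \<subseteq> X \<and> finite F \<and> (\<forall>x\<in>F. \<forall>y\<in>F. x \<noteq> y \<longrightarrow> r \<le> dist x y)" for F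
  have bound: "real (card F) * a \<le> measure \<mu> S" if "P F" for F
  proof -
    have F: "F \<subseteq> X" "finite F" "\<And>x y. x \<in> F \<Longrightarrow> y \<in> F \<Longrightarrow> x \<noteq> y \<Longrightarrow> r \<le> dist x y"
      using that unfolding P_def by blast+
    have disj: "disjoint_family_on (\<lambda>x. ball x (r / 2)) F"
      unfolding disjoint_family_on_def
    proof (intro ballI impI)
      fix x y assume "x \<in> F" "y \<in> F" "x \<noteq> y"
      then show "ball x (r / 2) \<inter> ball y (r / 2) = {}"
        using F(3)[of x y] by (intro disjoint_ballI) simp
    qed
    have "real (card F) * a = (\<Sum>x\<in>F. a)" by simp
    also have "\<dots> \<le> (\<Sum>x\<in>F. vol x (r / 2))" using F(1) X(2) by (intro sum_mono) auto
    also have "\<dots> = measure \<mu> (\<Union>x\<in>F. ball x (r / 2))"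
      unfolding vol_def using F(2) disj ball_finite
      by (intro measure_finite_Union[symmetric]) (auto simp: less_top)
    also have "\<dots> \<le> measure \<mu> S"
      using S F(1,2) X(1) by (intro measure_mono_fmeasurable fmeasurableI) auto
    finally show ?thesis .
  qed
  have "\<forall>F. P F \<longrightarrow> card F < Suc (nat \<lfloor>measure \<mu> S / a\<rfloor>)"
    using bound a by (simp add: less_Suc_eq_le le_nat_floor field_simps)
  moreover have "P {}" by (simp add: P_def)
  ultimately have "\<exists>F. P F \<and> (\<forall>F'. P F' \<longrightarrow> card F' \<le> card F)"
    by (intro ex_has_greatest_nat)
  then obtain F where F: "P F" "\<And>F'. P F' \<Longrightarrow> card F' \<le> card F" by blast
  have "x \<in> (\<Union>y\<in>F. ball y r)" if x: "x \<in> X" for x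
  proof (rule ccontr)
    assume "x \<notin> (\<Union>y\<in>F. ball y r)"
    then have d: "\<And>y. y \<in> F \<Longrightarrow> r \<le> dist y x" by (auto simp: not_less)
    then have "x \<notin> F" using r by force
    moreover have "P (insert x F)" using F(1) x d unfolding P_def by (auto simp: dist_commute)
    ultimately show False using F(1) F(2)[of "insert x F"] by (simp add: P_def)
  qed
  then show ?thesis using F(1) bound[OF F(1)] unfolding P_def by blast
qed

context frac_heat
begin

text \<open>
  The compact set is cut into time layers in geometric progression, and each layer is covered by
  parabolic balls of the corresponding size centred at a separated net; the net is counted by
  the measure of the shadow. Because \<open>p < q\<close> the contributions of the layers decay geometrically
  towards small times, and the largest layer is bounded by the shadow.
\<close>

lemma shadow_condition_if_ball_condition:
  assumes \<nu>: "radon_measure_on upper_half \<nu>" and pq: "1 < p" "p < q" and \<beta>: "0 < \<beta>" and c: "0 < c"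
    and a: "0 < a" "\<And>x r. 0 < r \<Longrightarrow> a * r powr \<beta> \<le> vol x r" and A: "0 < A"
    and balls: "\<And>r t0 x0. 0 < r \<Longrightarrow> 0 < t0 \<Longrightarrow> t0 \<le> c * r powr (2 * \<alpha>) \<Longrightarrow>
        emeasure \<nu> (parabolic_ball \<alpha> r t0 x0) \<le> ennreal (A * r powr (q * \<beta> / p))"
  shows "\<exists>B>0. \<forall>K. compact K \<longrightarrow> K \<subseteq> upper_half \<longrightarrow>
    emeasure \<nu> K \<le> ennreal (B * measure \<mu> (shadow K) powr (q / p))"
proof -
  \<comment> \<open>With \<open>t\<^sub>0 = \<epsilon> r\<^bsup>2 \<alpha>\<^esup>\<close> a parabolic ball covers the times between \<open>(1 + \<epsilon>) r\<^bsup>2 \<alpha>\<^esup>\<close> and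
    \<open>(2 + \<epsilon>) r\<^bsup>2 \<alpha>\<^esup>\<close>; for \<open>\<epsilon> \<le> 1 / 2\<close> the ratio of these exceeds \<open>4 / 3\<close>, the ratio of the layers.\<close>
  define \<epsilon> where "\<epsilon> = min c (1 / 2)"
  have e: "0 < \<epsilon>" "\<epsilon> \<le> c" "\<epsilon> \<le> 1 / 2" using c by (auto simp: \<epsilon>_def)
  \<comment> \<open>The layer at time \<open>\<tau>\<close> contributes at most a multiple of \<open>\<tau>\<^bsup>\<gamma>\<^esup>\<close>; \<open>\<gamma> > 0\<close> expresses \<open>p < q\<close>.\<close>
  define \<gamma> where "\<gamma> = \<beta> * (q / p - 1) / (2 * \<alpha>)"
  have g: "0 < \<gamma>" using \<beta> pq alpha by (simp add: \<gamma>_def)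
  define \<theta> :: real where "\<theta> = (3 / 4) powr \<gamma>"
  have th: "0 < \<theta>" "\<theta> < 1" using g powr_less_mono2[of \<gamma> "3 / 4" 1] by (auto simp: \<theta>_def)
  define B where "B = 2 powr \<beta> * A / a * (1 / a) powr (q / p - 1) / (1 - \<theta>)"
  have B: "0 < B" using A a(1) th by (simp add: B_def)
  have "emeasure \<nu> K \<le> ennreal (B * measure \<mu> (shadow K) powr (q / p))"
    if K: "compact K" "K \<subseteq> upper_half" for K
  proof (cases "K = {}")
    case False
    define m where "m = measure \<mu> (shadow K)"
    have fin: "emeasure \<mu> (shadow K) < \<infinity>" by (rule emeasure_shadow_finite[OF K])
    have S: "shadow K \<in> sets \<mu>" by (simp add: open_sets open_shadow)
    have pos: "0 < t" if "(t, x) \<in> K" for t x using that K(2) by (auto simp: upper_half_def)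
    have vm: "a * rad t powr \<beta> \<le> m" if "(t, x) \<in> K" for t x
    proof -
      have "a * rad t powr \<beta> \<le> vol x (rad t)" using pos[OF that] by (intro a(2) rad_pos)
      also have "\<dots> \<le> m" unfolding vol_def m_def
        using that fin S by (intro measure_mono_fmeasurable fmeasurableI) (auto simp: shadow_def)
      finally show ?thesis .
    qed
    have m: "0 < m"
    proof -
      obtain t x where tx: "(t, x) \<in> K" using False by auto
      have "0 < a * rad t powr \<beta>" using a(1) rad_pos[OF pos[OF tx]] by simp
      then show ?thesis using vm[OF tx] by linarith
    qed
    \<comment> \<open>An upper bound for the times in \<open>K\<close>, because the shadow contains a ball for each of them.\<close>
    define R where "R = (m / a) powr (2 * \<alpha> / \<beta>)"
    have R: "0 < R" using m a(1) by (simp add: R_def)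
    have tR: "t \<le> R" if "(t, x) \<in> K" for t x
    proof -
      have "t powr (\<beta> / (2 * \<alpha>)) \<le> m / a"
        using vm[OF that] a(1) by (simp add: rad_def powr_powr field_simps)
      then have "(t powr (\<beta> / (2 * \<alpha>))) powr (2 * \<alpha> / \<beta>) \<le> R"
        unfolding R_def using alpha \<beta> by (intro powr_mono2) auto
      then show ?thesis using pos[OF that] alpha \<beta> by (simp add: powr_powr)
    qed
    define \<tau> where "\<tau> j = (3 / 4) ^ j * R" for j :: nat
    define r where "r j = (\<tau> (Suc j) / (1 + \<epsilon>)) powr (1 / (2 * \<alpha>))" for j
    have tau: "0 < \<tau> j" for j using R by (simp add: \<tau>_def)
    have rpos: "0 < r j" for j using tau[of "Suc j"] e by (simp add: r_def)
    have rpow: "r j powr (2 * \<alpha>) = \<tau> (Suc j) / (1 + \<epsilon>)" for j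
      using tau[of "Suc j"] e alpha by (simp add: r_def powr_powr)
    define X where "X j = {x. \<exists>t. (t, x) \<in> K \<and> \<tau> (Suc j) < t \<and> t \<le> \<tau> j}" for j
    define b where "b j x = parabolic_ball \<alpha> (r j) (\<epsilon> * r j powr (2 * \<alpha>)) x" for j and x :: 'a
    have "\<forall>j. \<exists>F\<subseteq>X j. finite F \<and> X j \<subseteq> (\<Union>x\<in>F. ball x (r j)) \<and>
        real (card F) * (a * (r j / 2) powr \<beta>) \<le> m"
      unfolding m_def
    proof (rule allI, rule separated_net[OF rpos _ S fin])
      fix j
      show "0 < a * (r j / 2) powr \<beta>" using a(1) rpos[of j] by simp
    next
      fix j x assume "x \<in> X j"
      then obtain t where t: "(t, x) \<in> K" "\<tau> (Suc j) < t" by (auto simp: X_def)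
      have "\<tau> (Suc j) / (1 + \<epsilon>) \<le> \<tau> (Suc j)"
        using tau[of "Suc j"] e by (simp add: field_simps)
      then have "r j \<le> rad t"
        unfolding r_def rad_def using t(2) tau[of "Suc j"] e alpha by (intro powr_mono2) auto
      then have "ball x (r j / 2) \<subseteq> ball x (rad t)" using rpos[of j] by (intro subset_ball) simp
      then show "ball x (r j / 2) \<subseteq> shadow K" using t(1) by (auto simp: shadow_def)
    next
      fix j x
      show "a * (r j / 2) powr \<beta> \<le> vol x (r j / 2)" using rpos[of j] by (intro a(2)) simp
    qed
    from choice[OF this] obtain F where "\<forall>j. F j \<subseteq> X j \<and> finite (F j) \<and>
        X j \<subseteq> (\<Union>x\<in>F j. ball x (r j)) \<and> real (card (F j)) * (a * (r j / 2) powr \<beta>) \<le> m" ..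
    then have F: "\<And>j. F j \<subseteq> X j" "\<And>j. finite (F j)" "\<And>j. X j \<subseteq> (\<Union>x\<in>F j. ball x (r j))"
      "\<And>j. real (card (F j)) * (a * (r j / 2) powr \<beta>) \<le> m"
      by simp_all
    have cover: "K \<subseteq> (\<Union>j. \<Union>x\<in>F j. b j x)"
    proof
      fix z assume "z \<in> K"
      then obtain t x where tx: "z = (t, x)" "(t, x) \<in> K" by (cases z) auto
      have "(\<lambda>j. \<tau> j) \<longlonglongrightarrow> 0 * R"
        unfolding \<tau>_def by (intro tendsto_mult LIMSEQ_power_zero tendsto_const) simp
      then have "\<forall>\<^sub>F j in sequentially. \<tau> j < t" using pos[OF tx(2)] by (intro order_tendstoD) auto
      then obtain i where "\<tau> i < t" by (auto simp: eventually_sequentially)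
      then obtain j where j: "\<tau> j < t" "\<And>k. k < j \<Longrightarrow> \<not> \<tau> k < t"
        using exists_least_iff[of "\<lambda>j. \<tau> j < t"] by blast
      have "j \<noteq> 0" using j(1) tR[OF tx(2)] by (cases j) (auto simp: \<tau>_def)
      then obtain k where k: "j = Suc k" using not0_implies_Suc by blast
      have tk: "\<tau> (Suc k) < t" "t \<le> \<tau> k" using j k by (auto simp: not_less)
      then have "x \<in> X k" using tx(2) by (auto simp: X_def)
      then obtain y where y: "y \<in> F k" "dist y x < r k" using F(3)[of k] by auto
      have s: "\<tau> (Suc k) = (1 + \<epsilon>) * r k powr (2 * \<alpha>)" using e by (simp add: rpow)
      have "\<tau> k = 4 / 3 * \<tau> (Suc k)" by (simp add: \<tau>_def)
      then have "\<tau> k = 4 / 3 * (1 + \<epsilon>) * r k powr (2 * \<alpha>)" by (simp add: s)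
      also have "\<dots> < (2 + \<epsilon>) * r k powr (2 * \<alpha>)"
        using rpos[of k] e by (intro mult_strict_right_mono) auto
      finally have "t < (2 + \<epsilon>) * r k powr (2 * \<alpha>)" using tk(2) by linarith
      then have "(t, x) \<in> b k y"
        using tk(1) s y(2) pos[OF tx(2)]
        by (simp add: b_def parabolic_ball_def upper_half_def dist_commute algebra_simps)
      then show "z \<in> (\<Union>j. \<Union>x\<in>F j. b j x)" using y(1) tx(1) by blast
    qed
    have bs: "b j x \<in> sets \<nu>" for j x unfolding b_def by (rule parabolic_ball_sets[OF \<nu>])
    have layer: "emeasure \<nu> (\<Union>x\<in>F j. b j x) \<le> ennreal (2 powr \<beta> * A * m / a * R powr \<gamma> * \<theta> ^ j)" for j
    proof -
      have "emeasure \<nu> (\<Union>x\<in>F j. b j x) \<le> (\<Sum>x\<in>F j. emeasure \<nu> (b j x))"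
        using F(2) bs by (intro emeasure_subadditive_finite) auto
      also have "\<dots> \<le> (\<Sum>x\<in>F j. ennreal (A * r j powr (q * \<beta> / p)))"
        unfolding b_def using rpos[of j] e by (intro sum_mono balls) (auto intro: mult_right_mono)
      also have "\<dots> = ennreal (real (card (F j)) * (A * r j powr (q * \<beta> / p)))"
        using A by (simp add: ennreal_mult ennreal_of_nat_eq_real_of_nat)
      also have "\<dots> \<le> ennreal (2 powr \<beta> * A * m / a * R powr \<gamma> * \<theta> ^ j)"
      proof (rule ennreal_leI)
        have rb: "0 < r j powr \<beta>" using rpos[of j] by simp
        have "q * \<beta> / p = \<beta> + \<beta> * (q / p - 1)" by (simp add: algebra_simps)
        then have split: "r j powr (q * \<beta> / p) = r j powr \<beta> * r j powr (\<beta> * (q / p - 1))"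
          by (simp add: powr_add)
        have "real (card (F j)) * r j powr \<beta> \<le> 2 powr \<beta> * m / a"
          using F(4)[of j] a(1) rpos[of j] by (simp add: powr_divide field_simps)
        then have "real (card (F j)) * r j powr \<beta> * (A * r j powr (\<beta> * (q / p - 1)))
            \<le> 2 powr \<beta> * m / a * (A * r j powr (\<beta> * (q / p - 1)))"
          using A by (intro mult_right_mono) auto
        also have "r j powr (\<beta> * (q / p - 1)) = (\<tau> (Suc j) / (1 + \<epsilon>)) powr \<gamma>"
          by (simp add: r_def powr_powr \<gamma>_def)
        also have "2 powr \<beta> * m / a * (A * (\<tau> (Suc j) / (1 + \<epsilon>)) powr \<gamma>)
            \<le> 2 powr \<beta> * m / a * (A * ((3 / 4) ^ j * R) powr \<gamma>)"
        proof (intro mult_left_mono powr_mono2)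
          have "\<tau> (Suc j) \<le> (1 + \<epsilon>) * ((3 / 4) ^ j * R)"
          proof -
            have "\<tau> (Suc j) = 3 / 4 * ((3 / 4) ^ j * R)" by (simp add: \<tau>_def)
            also have "\<dots> \<le> (1 + \<epsilon>) * ((3 / 4) ^ j * R)" using e R by (intro mult_right_mono) auto
            finally show ?thesis .
          qed
          then show "\<tau> (Suc j) / (1 + \<epsilon>) \<le> (3 / 4) ^ j * R"
            using e by (simp add: pos_divide_le_eq mult.commute)
        qed (use tau[of "Suc j"] e g A m a(1) in auto)
        also have "((3 / 4) ^ j * R) powr \<gamma> = \<theta> ^ j * R powr \<gamma>"
          using R th by (simp add: powr_mult \<theta>_def powr_realpow[symmetric] powr_powr mult.commute)
        also have "real (card (F j)) * r j powr \<beta> * (A * (\<tau> (Suc j) / (1 + \<epsilon>)) powr \<gamma>)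
            = real (card (F j)) * (A * r j powr (q * \<beta> / p))"
          unfolding split by (simp add: r_def powr_powr \<gamma>_def)
        also have "2 powr \<beta> * m / a * (A * (\<theta> ^ j * R powr \<gamma>))
            = 2 powr \<beta> * A * m / a * R powr \<gamma> * \<theta> ^ j"
          by simp
        finally show "real (card (F j)) * (A * r j powr (q * \<beta> / p))
            \<le> 2 powr \<beta> * A * m / a * R powr \<gamma> * \<theta> ^ j" .
      qed
      finally show ?thesis .
    qed
    have "emeasure \<nu> K \<le> emeasure \<nu> (\<Union>j. \<Union>x\<in>F j. b j x)"
      using bs F(2) by (intro emeasure_mono cover sets.countable_UN sets.finite_UN) auto
    also have "\<dots> \<le> (\<Sum>j. emeasure \<nu> (\<Union>x\<in>F j. b j x))"
      using bs F(2) by (intro emeasure_subadditive_countably) auto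
    also have "\<dots> \<le> (\<Sum>j. ennreal (2 powr \<beta> * A * m / a * R powr \<gamma> * \<theta> ^ j))"
      by (intro suminf_le layer) auto
    also have "\<dots> = ennreal (\<Sum>j. 2 powr \<beta> * A * m / a * R powr \<gamma> * \<theta> ^ j)"
      using th A m a(1) by (intro suminf_ennreal2 summable_mult summable_geometric) auto
    also have "(\<Sum>j. 2 powr \<beta> * A * m / a * R powr \<gamma> * \<theta> ^ j) = 2 powr \<beta> * A * m / a * R powr \<gamma> * (1 / (1 - \<theta>))"
      using th by (subst suminf_mult) (auto simp: suminf_geometric summable_geometric)
    also have "\<dots> = B * m powr (q / p)"
    proof -
      have "R powr \<gamma> = (m / a) powr (q / p - 1)"
        using alpha \<beta> by (simp add: R_def \<gamma>_def powr_powr)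
      also have "\<dots> = m powr (q / p) / m * (1 / a) powr (q / p - 1)"
        using m a(1) by (simp add: powr_diff powr_divide)
      finally show ?thesis using m by (simp add: B_def)
    qed
    finally show ?thesis by (simp add: m_def)
  qed simp
  then show ?thesis using B by blast
qed

text \<open>
  The extension of the indicator of a ball of radius comparable to \<open>r\<close> is bounded below on
  the parabolic ball, and the volume bound controls the norm of this indicator.
\<close>

lemma ball_condition_if_bounded:
  assumes \<nu>: "radon_measure_on upper_half \<nu>" and pq: "1 < p" "p \<le> q" and \<beta>: "0 < \<beta>" and c: "0 < c"
    and b: "0 < b" "\<And>x r. 0 < r \<Longrightarrow> vol x r \<le> b * r powr \<beta>"
    and bd: "Lp_Lq_bounded \<mu> p \<nu> q (frac_extension \<mu> \<eta> h)"
  shows "\<exists>A>0. \<forall>r>0. \<forall>t0>0. \<forall>x0. t0 \<le> c * r powr (2 * \<alpha>) \<longrightarrow>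
    emeasure \<nu> (parabolic_ball \<alpha> r t0 x0) \<le> ennreal (A * r powr (q * \<beta> / p))"
proof -
  let ?T = "frac_extension \<mu> \<eta> h"
  obtain B where B: "0 \<le> B" "\<And>f. f \<in> Lp_space \<mu> p \<Longrightarrow> ?T f \<in> Lp_space \<nu> q"
    "\<And>f. f \<in> Lp_space \<mu> p \<Longrightarrow> Lp_norm \<nu> q (?T f) \<le> B * Lp_norm \<mu> p f"
    using bd unfolding Lp_Lq_bounded_def by blast
  obtain \<kappa> where k: "0 < \<kappa>" "\<And>S t x. S \<in> sets \<mu> \<Longrightarrow> 0 < t \<Longrightarrow> ball x (rad t) \<subseteq> S \<Longrightarrow>
      \<kappa> \<le> ?T (indicat_real S) (t, x)"
    using frac_extension_indicator_lower by blast
  \<comment> \<open>All balls of radius \<open>rad t\<close> about points of the parabolic ball lie in the ball of radius \<open>\<Gamma> r\<close>.\<close>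
  define \<Gamma> where "\<Gamma> = 1 + (2 + c) powr (1 / (2 * \<alpha>))"
  have G: "0 < \<Gamma>" by (simp add: \<Gamma>_def add_pos_nonneg)
  define A where "A = ((B + 1) / \<kappa>) powr q * (b * \<Gamma> powr \<beta>) powr (q / p)"
  have A: "0 < A" using B(1) k(1) b(1) G by (simp add: A_def)
  have "emeasure \<nu> (parabolic_ball \<alpha> r t0 x0) \<le> ennreal (A * r powr (q * \<beta> / p))"
    if r: "0 < r" and t0: "0 < t0" "t0 \<le> c * r powr (2 * \<alpha>)" for r t0 x0
  proof -
    let ?S = "ball x0 (\<Gamma> * r)"
    let ?f = "indicat_real ?S"
    have "(\<integral>\<^sup>+y. ennreal (\<bar>?f y\<bar> powr p) \<partial>\<mu>) = (\<integral>\<^sup>+y. indicator ?S y \<partial>\<mu>)"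
      using pq by (intro nn_integral_cong) (auto split: split_indicator)
    then have I: "(\<integral>\<^sup>+y. ennreal (\<bar>?f y\<bar> powr p) \<partial>\<mu>) = ennreal (vol x0 (\<Gamma> * r))"
      by (simp add: emeasure_ball)
    then have f: "?f \<in> Lp_space \<mu> p" by (simp add: Lp_space_def)
    have nf: "Lp_norm \<mu> p ?f \<le> ((b * \<Gamma> powr \<beta>) * r powr \<beta>) powr (1 / p)"
    proof -
      have "vol x0 (\<Gamma> * r) \<le> b * (\<Gamma> * r) powr \<beta>" using G r by (intro b(2)) simp
      then have "vol x0 (\<Gamma> * r) \<le> (b * \<Gamma> powr \<beta>) * r powr \<beta>" using G r by (simp add: powr_mult)
      then show ?thesis unfolding Lp_norm_def I using pq by (simp add: vol_nonneg powr_mono2)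
    qed
    define J where "J = (\<integral>\<^sup>+z. ennreal (\<bar>?T ?f z\<bar> powr q) \<partial>\<nu>)"
    have [measurable]: "?T ?f \<in> borel_measurable \<nu>" using B(2)[OF f] by (simp add: Lp_space_def)
    have Jfin: "J < \<infinity>" using B(2)[OF f] by (simp add: Lp_space_def J_def)
    have T: "\<kappa> \<le> ?T ?f z" if z: "z \<in> parabolic_ball \<alpha> r t0 x0" for z
    proof -
      obtain t x where tx: "z = (t, x)" "0 < t" "t - t0 < 2 * r powr (2 * \<alpha>)" "dist x x0 < r"
        using z by (auto simp: parabolic_ball_def upper_half_def)
      have "t \<le> (2 + c) * r powr (2 * \<alpha>)" using tx(3) t0(2) by (simp add: distrib_right)
      then have "rad t \<le> ((2 + c) * r powr (2 * \<alpha>)) powr (1 / (2 * \<alpha>))"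
        unfolding rad_def using alpha tx(2) by (intro powr_mono2) auto
      also have "\<dots> = (2 + c) powr (1 / (2 * \<alpha>)) * r"
        using alpha r c by (simp add: powr_mult powr_powr)
      finally have "dist x x0 + rad t \<le> \<Gamma> * r" using tx(4) by (simp add: \<Gamma>_def distrib_right)
      then have "ball x (rad t) \<subseteq> ?S"
      proof (intro subsetI)
        fix y assume "y \<in> ball x (rad t)"
        then show "y \<in> ?S" using \<open>dist x x0 + rad t \<le> \<Gamma> * r\<close> dist_triangle[of x0 y x]
          by (simp add: dist_commute)
      qed
      then show ?thesis unfolding tx(1) by (intro k(2) tx(2)) auto
    qed
    let ?E = "{z \<in> space \<nu>. \<kappa> \<le> ?T ?f z}"
    have Es: "?E \<in> sets \<nu>" by measurable
    have "ennreal (\<kappa> powr q) * emeasure \<nu> (parabolic_ball \<alpha> r t0 x0) \<le> ennreal (\<kappa> powr q) * emeasure \<nu> ?E"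
      using T sets.sets_into_space[OF parabolic_ball_sets[OF \<nu>, of \<alpha> r t0 x0]]
      by (intro mult_left_mono emeasure_mono Es) auto
    also have "\<dots> = (\<integral>\<^sup>+z. ennreal (\<kappa> powr q) * indicator ?E z \<partial>\<nu>)"
      by (rule nn_integral_cmult_indicator[OF Es, symmetric])
    also have "\<dots> \<le> J" unfolding J_def
      using k(1) pq by (intro nn_integral_mono) (auto split: split_indicator intro!: ennreal_leI powr_mono2)
    also have "J \<le> ennreal (((B + 1) * Lp_norm \<mu> p ?f) powr q)"
    proof -
      have "enn2real J powr (1 / q) \<le> B * Lp_norm \<mu> p ?f"
        using B(3)[OF f] by (simp add: Lp_norm_def J_def)
      also have "\<dots> \<le> (B + 1) * Lp_norm \<mu> p ?f" by (intro mult_right_mono) (auto simp: Lp_norm_def)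
      finally have "(enn2real J powr (1 / q)) powr q \<le> ((B + 1) * Lp_norm \<mu> p ?f) powr q"
        using pq by (intro powr_mono2) auto
      then have "enn2real J \<le> ((B + 1) * Lp_norm \<mu> p ?f) powr q" using pq by (simp add: powr_powr)
      then show ?thesis using Jfin by (metis ennreal_enn2real ennreal_leI infinity_ennreal_def)
    qed
    also have "\<dots> \<le> ennreal (((B + 1) * ((b * \<Gamma> powr \<beta>) * r powr \<beta>) powr (1 / p)) powr q)"
      using B(1) pq nf by (intro ennreal_leI powr_mono2 mult_left_mono) (auto simp: Lp_norm_def)
    also have "((B + 1) * ((b * \<Gamma> powr \<beta>) * r powr \<beta>) powr (1 / p)) powr q
        = \<kappa> powr q * (A * r powr (q * \<beta> / p))"
      using B(1) k(1) by (simp add: A_def powr_mult powr_powr powr_divide mult_ac)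
    also have "ennreal \<dots> = ennreal (\<kappa> powr q) * ennreal (A * r powr (q * \<beta> / p))"
      using A by (intro ennreal_mult) auto
    finally have "ennreal (\<kappa> powr q) * emeasure \<nu> (parabolic_ball \<alpha> r t0 x0)
        \<le> ennreal (\<kappa> powr q) * ennreal (A * r powr (q * \<beta> / p))" .
    then show ?thesis using k(1) by (subst (asm) ennreal_mult_le_mult_iff) auto
  qed
  then show ?thesis using A by blast
qed

end

section \<open>Doubling from the heat kernel\<close>

text \<open>
  The heat kernel at \<open>x\<close> has mass at most one, and on the ball of radius \<open>5 r\<close> it is
  at least a fixed multiple of \<open>1 / \<mu>(B(x,r))\<close> at time \<open>r\<^sup>2\<close>. This compares the
  two balls for almost all centres \<open>x\<close>; as balls have positive measure, such centres are dense.
\<close>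

lemma heat_kernel_doubling:
  fixes \<mu> :: "'a::{metric_space,second_countable_topology} measure"
  assumes \<mu>: "sets \<mu> = sets borel" and hk: "heat_kernel \<mu> h" and C: "0 < C"
    and gb: "gaussian_bounds \<mu> h C" and pos: "\<And>x r. 0 < r \<Longrightarrow> 0 < emeasure \<mu> (ball x r)"
  shows "\<exists>D\<ge>2. \<forall>x. \<forall>r>0. emeasure \<mu> (ball x (2 * r)) \<le> ennreal D * emeasure \<mu> (ball x r)"
proof -
  have [simp]: "space \<mu> = UNIV" using sets_eq_imp_space_eq[OF \<mu>] by simp
  have bs [simp]: "ball x r \<in> sets \<mu>" for x r by (simp add: \<mu>)
  obtain c1 where c1: "0 < c1" "\<And>x y s. 0 < s \<Longrightarrow>
      c1 * (1 / measure \<mu> (ball x (sqrt s)) * exp (- C * (dist x y)\<^sup>2 / s)) \<le> h s x y"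
    using gb unfolding gaussian_bounds_def by blast
  define good where "good x \<longleftrightarrow> (\<forall>t>0. (\<integral>\<^sup>+z. ennreal (h t x z) \<partial>\<mu>) \<le> 1)" for x
  \<comment> \<open>The mass bound does not mention \<open>y\<close>, so that one admissible \<open>y\<close> suffices; it exists as \<open>\<mu> \<noteq> 0\<close>.\<close>
  have nb: "ae_filter \<mu> \<noteq> bot"
    using pos[of 1 undefined] emeasure_space[of \<mu> "ball undefined 1"]
    by (auto simp: ae_filter_eq_bot_iff)
  have "AE x in \<mu>. AE y in \<mu>. \<forall>s>0. \<forall>t>0.
        0 \<le> h t x y \<and> (\<integral>\<^sup>+ z. ennreal (h t x z) \<partial>\<mu>) \<le> 1 \<and> h t x y = h t y x \<and>
        ennreal (h (s + t) x y) = (\<integral>\<^sup>+ z. ennreal (h s x z * h t z y) \<partial>\<mu>)"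
    using hk unfolding heat_kernel_def by (elim conjE) assumption
  then have AE_good: "AE x in \<mu>. good x"
  proof (rule eventually_mono)
    fix x assume *: "AE y in \<mu>. \<forall>s>0. \<forall>t>0.
        0 \<le> h t x y \<and> (\<integral>\<^sup>+ z. ennreal (h t x z) \<partial>\<mu>) \<le> 1 \<and> h t x y = h t y x \<and>
        ennreal (h (s + t) x y) = (\<integral>\<^sup>+ z. ennreal (h s x z * h t z y) \<partial>\<mu>)"
    obtain y where "\<forall>s>0. \<forall>t>0.
        0 \<le> h t x y \<and> (\<integral>\<^sup>+ z. ennreal (h t x z) \<partial>\<mu>) \<le> 1 \<and> h t x y = h t y x \<and>
        ennreal (h (s + t) x y) = (\<integral>\<^sup>+ z. ennreal (h s x z * h t z y) \<partial>\<mu>)"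
      using eventually_happens[OF *] nb by blast
    then show "good x" unfolding good_def using zero_less_one by blast
  qed
  define E where "E = exp (25 * C) / c1"
  have E: "0 < E" using c1(1) by (simp add: E_def)
  have five: "emeasure \<mu> (ball x (5 * r)) \<le> ennreal E * emeasure \<mu> (ball x r)"
    if good: "good x" and r: "0 < r" for x r
  proof (cases "emeasure \<mu> (ball x r) = \<infinity>")
    case True
    then show ?thesis using E by (simp add: ennreal_mult_top)
  next
    case False
    define v where "v = measure \<mu> (ball x r)"
    have v: "emeasure \<mu> (ball x r) = ennreal v"
      using False by (simp add: v_def emeasure_eq_ennreal_measure)
    then have v0: "0 < v" using pos[OF r, of x] by simp
    have low: "c1 / v * exp (- 25 * C) \<le> h (r\<^sup>2) x z" if z: "z \<in> ball x (5 * r)" for z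
    proof -
      have "(dist x z)\<^sup>2 \<le> (5 * r)\<^sup>2" using z by (intro power_mono) auto
      then have "C * (dist x z)\<^sup>2 / r\<^sup>2 \<le> 25 * C"
        using r C by (simp add: power_mult_distrib divide_le_eq)
      then have "c1 * (1 / v * exp (- 25 * C)) \<le> c1 * (1 / v * exp (- C * (dist x z)\<^sup>2 / r\<^sup>2))"
        using c1(1) v0 by (intro mult_left_mono) auto
      also have "\<dots> \<le> h (r\<^sup>2) x z" using c1(2)[of "r\<^sup>2" x z] r by (simp add: v_def)
      finally show ?thesis by simp
    qed
    have "ennreal (c1 / v * exp (- 25 * C)) * emeasure \<mu> (ball x (5 * r))
        = (\<integral>\<^sup>+z. ennreal (c1 / v * exp (- 25 * C)) * indicator (ball x (5 * r)) z \<partial>\<mu>)"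
      by (rule nn_integral_cmult_indicator[symmetric]) simp
    also have "\<dots> \<le> (\<integral>\<^sup>+z. ennreal (h (r\<^sup>2) x z) \<partial>\<mu>)"
      using low by (intro nn_integral_mono) (auto split: split_indicator intro: ennreal_leI)
    also have "\<dots> \<le> 1" using good r by (simp add: good_def)
    finally have "ennreal (E * v) * (ennreal (c1 / v * exp (- 25 * C)) * emeasure \<mu> (ball x (5 * r))) \<le> ennreal (E * v) * 1"
      by (rule mult_left_mono) simp
    moreover have "ennreal (E * v) * ennreal (c1 / v * exp (- 25 * C)) = 1"
      using v0 c1(1) E by (simp add: ennreal_mult[symmetric] E_def exp_minus)
    ultimately have "emeasure \<mu> (ball x (5 * r)) \<le> ennreal (E * v)" by (simp add: mult.assoc[symmetric])
    then show ?thesis using E v0 by (simp add: v ennreal_mult)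
  qed
  have "emeasure \<mu> (ball x (2 * r)) \<le> ennreal (max 2 E) * emeasure \<mu> (ball x r)" if r: "0 < r" for x r
  proof -
    obtain y where y: "good y" "dist x y < r / 2"
    proof (rule ccontr)
      assume "\<not> thesis"
      with that have "ball x (r / 2) \<subseteq> {y \<in> space \<mu>. \<not> good y}" by auto
      moreover obtain N where "{y \<in> space \<mu>. \<not> good y} \<subseteq> N" "emeasure \<mu> N = 0" "N \<in> sets \<mu>"
        using AE_good by (rule AE_E)
      ultimately have "emeasure \<mu> (ball x (r / 2)) \<le> 0" using emeasure_mono[of "ball x (r / 2)" N \<mu>] by auto
      then show False using pos[of "r / 2" x] r by simp
    qed
    have "ball x (2 * r) \<subseteq> ball y (5 * (r / 2))"
    proof
      fix z assume "z \<in> ball x (2 * r)"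
      then show "z \<in> ball y (5 * (r / 2))"
        using y(2) dist_triangle[of y z x] by (simp add: dist_commute)
    qed
    then have "emeasure \<mu> (ball x (2 * r)) \<le> emeasure \<mu> (ball y (5 * (r / 2)))" by (intro emeasure_mono) auto
    also have "\<dots> \<le> ennreal E * emeasure \<mu> (ball y (r / 2))" using r by (intro five y(1)) simp
    also have "\<dots> \<le> ennreal (max 2 E) * emeasure \<mu> (ball x r)"
    proof (intro mult_mono emeasure_mono)
      show "ball y (r / 2) \<subseteq> ball x r"
      proof
        fix z assume "z \<in> ball y (r / 2)"
        then show "z \<in> ball x r" using y(2) dist_triangle[of x z y] by simp
      qed
    qed (auto intro: ennreal_leI)
    finally show ?thesis .
  qed
  then show ?thesis by (intro exI[of _ "max 2 E"]) auto
qed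

text \<open>
  Iterated doubling reaches every ball from one ball of finite measure, so the measure is
  finite on all balls or infinite on all balls.
\<close>

lemma doubling_finite_balls:
  fixes \<mu> :: "'a::{metric_space,second_countable_topology} measure"
  assumes \<mu>: "sets \<mu> = sets borel"
    and D: "\<And>x r. 0 < r \<Longrightarrow> emeasure \<mu> (ball x (2 * r)) \<le> ennreal D * emeasure \<mu> (ball x r)"
    and fin: "0 < r0" "emeasure \<mu> (ball x0 r0) < \<infinity>"
  shows "emeasure \<mu> (ball x r) < \<infinity>"
proof -
  have *: "emeasure \<mu> (ball x0 (2 ^ k * r0)) < \<infinity>" for k :: nat
  proof (induction k)
    case (Suc k)
    have "emeasure \<mu> (ball x0 (2 ^ Suc k * r0)) \<le> ennreal D * emeasure \<mu> (ball x0 (2 ^ k * r0))"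
      using D[of "2 ^ k * r0" x0] fin(1) by (simp add: mult_ac)
    also have "\<dots> < \<infinity>" using Suc by (simp add: ennreal_mult_less_top)
    finally show ?case .
  qed (use fin(2) in simp)
  obtain k :: nat where k: "(dist x0 x + r) / r0 < 2 ^ k"
    using real_arch_pow[of 2 "(dist x0 x + r) / r0"] by auto
  have "ball x r \<subseteq> ball x0 (2 ^ k * r0)"
  proof
    fix z assume "z \<in> ball x r"
    moreover have "dist x0 x + r < 2 ^ k * r0" using k fin(1) by (simp add: pos_divide_less_eq)
    ultimately show "z \<in> ball x0 (2 ^ k * r0)"
      using dist_triangle[of x0 z x] by simp
  qed
  then have "emeasure \<mu> (ball x r) \<le> emeasure \<mu> (ball x0 (2 ^ k * r0))"
    by (intro emeasure_mono) (auto simp: \<mu>)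
  then show ?thesis using *[of k] by (rule le_less_trans)
qed

section \<open>The boundedness criteria\<close>

lemma SUP_divide_finite_iff:
  fixes g :: "'i \<Rightarrow> real" and k :: "'i \<Rightarrow> ennreal"
  assumes g: "\<And>l. l \<in> S \<Longrightarrow> 0 < g l"
  shows "(SUP l\<in>S. ennreal (g l) / k l) < \<infinity> \<longleftrightarrow> (\<exists>A>0. \<forall>l\<in>S. ennreal (g l) \<le> ennreal A * k l)"
proof
  assume fin: "(SUP l\<in>S. ennreal (g l) / k l) < \<infinity>"
  define A where "A = enn2real (SUP l\<in>S. ennreal (g l) / k l) + 1"
  have A: "0 < A" by (simp add: A_def add_nonneg_pos)
  have "ennreal (g l) \<le> ennreal A * k l" if l: "l \<in> S" for l
  proof -
    have "ennreal (g l) / k l \<le> (SUP l\<in>S. ennreal (g l) / k l)" using l by (rule SUP_upper)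
    also have "\<dots> \<le> ennreal A" using fin
      by (cases "SUP l\<in>S. ennreal (g l) / k l") (auto simp: A_def intro: ennreal_leI)
    finally have *: "ennreal (g l) / k l \<le> ennreal A" .
    show ?thesis
    proof (cases "k l")
      case (real x)
      have "0 < x"
      proof (rule ccontr)
        assume "\<not> 0 < x"
        then have "k l = 0" using real by simp
        then have "ennreal (g l) / k l = top" using g[OF l] by (simp add: divide_ennreal_def)
        then show False using * by (simp add: top_unique)
      qed
      then have "g l / x \<le> A" using * real A g[OF l] by (simp add: divide_ennreal)
      then have "g l \<le> A * x" using \<open>0 < x\<close> by (simp add: pos_divide_le_eq)
      then show ?thesis using real A by (simp add: ennreal_mult[symmetric] ennreal_leI)
    next
      case top
      then show ?thesis using A by (simp add: ennreal_mult_top)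
    qed
  qed
  then show "\<exists>A>0. \<forall>l\<in>S. ennreal (g l) \<le> ennreal A * k l" using A by blast
next
  assume "\<exists>A>0. \<forall>l\<in>S. ennreal (g l) \<le> ennreal A * k l"
  then obtain A where A: "0 < A" "\<And>l. l \<in> S \<Longrightarrow> ennreal (g l) \<le> ennreal A * k l" by blast
  have "ennreal (g l) / k l \<le> ennreal A" if l: "l \<in> S" for l
  proof (cases "k l")
    case (real x)
    have "ennreal (g l) \<le> ennreal (A * x)" using A(2)[OF l] real A(1) by (simp add: ennreal_mult)
    then have "g l \<le> A * x" using A(1) real by (subst (asm) ennreal_le_iff) auto
    then have "0 < x" using g[OF l] real A(1) by (cases "x = 0") auto
    then show ?thesis using \<open>g l \<le> A * x\<close> real g[OF l]
      by (simp add: divide_ennreal pos_divide_le_eq ennreal_leI)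
  qed simp
  then have "(SUP l\<in>S. ennreal (g l) / k l) \<le> ennreal A" by (rule SUP_least)
  then show "(SUP l\<in>S. ennreal (g l) / k l) < \<infinity>" by (rule le_less_trans) simp
qed

text \<open>
  If the measure is infinite on all balls, both Gaussian bounds are zero by the convention
  for \<open>measure\<close>, so the heat kernel and with it the extension vanish.
\<close>

lemma bounded_if_infinite_balls:
  assumes gb: "gaussian_bounds \<mu> h C" and inf: "\<And>x r. 0 < r \<Longrightarrow> emeasure \<mu> (ball x r) = \<infinity>" and q: "0 < q"
  shows "Lp_Lq_bounded \<mu> p \<nu> q (frac_extension \<mu> \<eta> h)"
proof -
  obtain c1 c2 where bounds: "\<And>x y s. 0 < s \<Longrightarrow>
        c1 * (1 / measure \<mu> (ball x (sqrt s)) * exp (- C * (dist x y)\<^sup>2 / s)) \<le> h s x y"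
      "\<And>x y s. 0 < s \<Longrightarrow>
        h s x y \<le> c2 * (1 / measure \<mu> (ball x (sqrt s)) * exp (- C * (dist x y)\<^sup>2 / s))"
    using gb unfolding gaussian_bounds_def by blast
  have "h s x y = 0" if "0 < s" for s x y
  proof -
    have "measure \<mu> (ball x (sqrt s)) = 0" using inf[of "sqrt s" x] that by (simp add: measure_def)
    then show ?thesis using bounds[OF that, of x y] by simp
  qed
  then have "frac_kernel \<eta> h t x y = 0" for t x y
    unfolding frac_kernel_def set_lebesgue_integral_def
    by (intro integral_eq_zero_AE AE_I2) (auto simp: indicator_def)
  then have "frac_extension \<mu> \<eta> h f = (\<lambda>_. 0)" for f
    by (auto simp: frac_extension_def)
  then show ?thesis unfolding Lp_Lq_bounded_def using q
    by (intro exI[of _ 0]) (auto simp: Lp_space_def Lp_norm_def)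
qed

theorem theorem5p3:
  fixes \<mu> :: "'a::{metric_space,second_countable_topology} measure"
    and h :: "real \<Rightarrow> 'a \<Rightarrow> 'a \<Rightarrow> real"
    and \<eta> :: "real \<Rightarrow> real \<Rightarrow> real"
    and \<nu> :: "(real \<times> 'a) measure"
    and \<alpha> \<beta> \<beta>s C p q :: real
  assumes "metric_measure_space \<mu>"
    and "0 < \<beta>" "ennreal \<beta> \<le> hausdorff_dim (UNIV :: 'a set)"
    and "0 < \<beta>s" "ennreal \<beta>s \<le> hausdorff_dim (UNIV :: 'a set)"
    and "0 < \<alpha>" "\<alpha> < 1"
    and "subordination_density \<alpha> \<eta>"
    and "heat_kernel \<mu> h"
    and "0 < C" "gaussian_bounds \<mu> h C"
    and "1 < p" "p \<le> q"
    and "radon_measure_on upper_half \<nu>"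
    and "(INF (x, r)\<in>UNIV \<times> {0<..}. emeasure \<mu> (ball x r) / ennreal (r powr \<beta>s)) > 0"
  shows "(Lp_Lq_bounded \<mu> p \<nu> q (frac_extension \<mu> \<eta> h) \<longleftrightarrow>
           (SUP l\<in>{0<..}. ennreal (l powr (p / q)) / capacity_minimizing \<mu> \<eta> h p \<nu> l) < \<infinity>)
    \<and> ((SUP (x, r)\<in>UNIV \<times> {0<..}. emeasure \<mu> (ball x r) / ennreal (r powr \<beta>)) < \<infinity> \<longrightarrow>
       \<beta> = \<beta>s \<longrightarrow> p < q \<longrightarrow>
       (\<forall>c>0.
         ((\<exists>A>0. \<forall>l>0. ennreal (l powr (p / q)) \<le> ennreal A * capacity_minimizing \<mu> \<eta> h p \<nu> l) \<longleftrightarrow>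
          (\<exists>A>0. \<forall>r>0. \<forall>t\<^sub>0>0. \<forall>x\<^sub>0. t\<^sub>0 \<le> c * r powr (2 * \<alpha>) \<longrightarrow>
             emeasure \<nu> (parabolic_ball \<alpha> r t\<^sub>0 x\<^sub>0) \<le> ennreal (A * r powr (q * \<beta> / p)))) \<and>
         (Lp_Lq_bounded \<mu> p \<nu> q (frac_extension \<mu> \<eta> h) \<longleftrightarrow>
          (\<exists>A>0. \<forall>r>0. \<forall>t\<^sub>0>0. \<forall>x\<^sub>0. t\<^sub>0 \<le> c * r powr (2 * \<alpha>) \<longrightarrow>
             emeasure \<nu> (parabolic_ball \<alpha> r t\<^sub>0 x\<^sub>0) \<le> ennreal (A * r powr (q * \<beta> / p))))))"
proof -
  let ?T = "frac_extension \<mu> \<eta> h"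
  let ?cap = "\<exists>A>0. \<forall>l>0. ennreal (l powr (p / q)) \<le> ennreal A * capacity_minimizing \<mu> \<eta> h p \<nu> l"
  let ?balls = "\<lambda>c. \<exists>A>0. \<forall>r>0. \<forall>t0>0. \<forall>x0. t0 \<le> c * r powr (2 * \<alpha>) \<longrightarrow>
      emeasure \<nu> (parabolic_ball \<alpha> r t0 x0) \<le> ennreal (A * r powr (q * \<beta> / p))"
  note \<nu> = \<open>radon_measure_on upper_half \<nu>\<close> and pq = \<open>1 < p\<close> \<open>p \<le> q\<close>
  have \<mu>: "sets \<mu> = sets borel"
    using \<open>metric_measure_space \<mu>\<close> by (simp add: metric_measure_space_def)
  obtain c1 c2 where c: "0 < c1" "0 < c2"
    and gb: "\<And>x y s. 0 < s \<Longrightarrow>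
        c1 * (1 / measure \<mu> (ball x (sqrt s)) * exp (- C * (dist x y)\<^sup>2 / s)) \<le> h s x y"
      "\<And>x y s. 0 < s \<Longrightarrow>
        h s x y \<le> c2 * (1 / measure \<mu> (ball x (sqrt s)) * exp (- C * (dist x y)\<^sup>2 / s))"
    using \<open>gaussian_bounds \<mu> h C\<close> unfolding gaussian_bounds_def by blast
  have hm: "(\<lambda>(t, x, y). h t x y) \<in> borel_measurable (restrict_space borel {0<..} \<Otimes>\<^sub>M (\<mu> \<Otimes>\<^sub>M \<mu>))"
    using \<open>heat_kernel \<mu> h\<close> unfolding heat_kernel_def by (elim conjE) assumption
  obtain a where a: "0 < a" "\<And>x r. 0 < r \<Longrightarrow> ennreal (a * r powr \<beta>s) \<le> emeasure \<mu> (ball x r)"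
  proof -
    obtain e where e: "0 < e" "e < (INF (x, r)\<in>UNIV \<times> {0<..}. emeasure \<mu> (ball x r) / ennreal (r powr \<beta>s))"
      using dense[OF assms(15)] by blast
    then have "e < top" using less_le_trans[OF e(2) top_greatest] by simp
    define a where "a = enn2real e"
    have a: "e = ennreal a" "0 < a" using e(1) \<open>e < top\<close> by (auto simp: a_def enn2real_positive_iff)
    have "ennreal (a * r powr \<beta>s) \<le> emeasure \<mu> (ball x r)" if r: "0 < r" for x r
    proof -
      have "e \<le> (case (x, r) of (x, r) \<Rightarrow> emeasure \<mu> (ball x r) / ennreal (r powr \<beta>s))"
        using r by (intro order_trans[OF less_imp_le[OF e(2)] INF_lower]) auto
      then have "e \<le> emeasure \<mu> (ball x r) / ennreal (r powr \<beta>s)" by simp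
      then have "ennreal a * ennreal (r powr \<beta>s) \<le> emeasure \<mu> (ball x r) / ennreal (r powr \<beta>s) * ennreal (r powr \<beta>s)"
        unfolding a(1) by (rule mult_right_mono) simp
      also have "\<dots> = emeasure \<mu> (ball x r)"
        using r by (simp add: ennreal_divide_times ennreal_divide_self)
      finally show ?thesis using a(2) by (simp add: ennreal_mult)
    qed
    then show thesis using that a(2) by blast
  qed
  have pos: "0 < emeasure \<mu> (ball x r)" if "0 < r" for x r
    using less_le_trans[OF _ a(2)[OF that]] a(1) that by simp
  obtain D where D: "2 \<le> D" "\<And>x r. 0 < r \<Longrightarrow> emeasure \<mu> (ball x (2 * r)) \<le> ennreal D * emeasure \<mu> (ball x r)"
    using heat_kernel_doubling[OF \<mu> \<open>heat_kernel \<mu> h\<close> \<open>0 < C\<close> \<open>gaussian_bounds \<mu> h C\<close> pos] by blast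
  have kernel: "frac_heat \<mu> D h \<eta> \<alpha> C c1 c2" if fin: "\<And>x r. emeasure \<mu> (ball x r) < \<infinity>"
  proof -
    interpret doubling_space \<mu> D
      using \<mu> fin pos D by unfold_locales auto
    show ?thesis
      using assms(6,8,10) hm c gb by unfold_locales (auto simp: vol_def)
  qed
  have capacity: "?cap \<longleftrightarrow> Lp_Lq_bounded \<mu> p \<nu> q ?T"
  proof
    assume cap: ?cap
    show "Lp_Lq_bounded \<mu> p \<nu> q ?T"
    proof (cases "\<exists>x r. 0 < r \<and> emeasure \<mu> (ball x r) < \<infinity>")
      case True
      then have "emeasure \<mu> (ball x r) < \<infinity>" for x r
        using doubling_finite_balls[OF \<mu> D(2)] by blast
      then interpret frac_heat \<mu> D h \<eta> \<alpha> C c1 c2 by (rule kernel)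
      show ?thesis using cap bounded_if_capacity_condition[OF \<nu> pq] by blast
    next
      case False
      have "emeasure \<mu> (ball x r) = \<infinity>" if "0 < r" for x r
      proof -
        have "\<not> emeasure \<mu> (ball x r) < \<infinity>" using False that by blast
        then show ?thesis by (simp add: not_less top_unique)
      qed
      then show ?thesis using pq by (intro bounded_if_infinite_balls[OF \<open>gaussian_bounds \<mu> h C\<close>]) auto
    qed
  qed (rule capacity_condition_if_bounded[OF \<nu> pq])
  have balls: "Lp_Lq_bounded \<mu> p \<nu> q ?T \<longleftrightarrow> ?balls c"
    if sup: "(SUP (x, r)\<in>UNIV \<times> {0<..}. emeasure \<mu> (ball x r) / ennreal (r powr \<beta>)) < \<infinity>"
      and "\<beta> = \<beta>s" "p < q" "0 < c" for c
  proof -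
    define b where "b = enn2real (SUP (x, r)\<in>UNIV \<times> {0<..}. emeasure \<mu> (ball x r) / ennreal (r powr \<beta>)) + 1"
    have b: "0 < b" by (simp add: b_def add_nonneg_pos)
    have up: "emeasure \<mu> (ball x r) \<le> ennreal (b * r powr \<beta>)" if r: "0 < r" for x r
    proof -
      have "emeasure \<mu> (ball x r) / ennreal (r powr \<beta>)
          \<le> (SUP (x, r)\<in>UNIV \<times> {0<..}. emeasure \<mu> (ball x r) / ennreal (r powr \<beta>))"
        using r by (intro SUP_upper2[of "(x, r)"]) auto
      also have "\<dots> \<le> ennreal b"
        using sup by (cases "SUP (x, r)\<in>UNIV \<times> {0<..}. emeasure \<mu> (ball x r) / ennreal (r powr \<beta>)")
          (auto simp: b_def intro: ennreal_leI)
      finally have "emeasure \<mu> (ball x r) / ennreal (r powr \<beta>) * ennreal (r powr \<beta>) \<le> ennreal b * ennreal (r powr \<beta>)"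
        by (rule mult_right_mono) simp
      moreover have "emeasure \<mu> (ball x r) / ennreal (r powr \<beta>) * ennreal (r powr \<beta>) = emeasure \<mu> (ball x r)"
        using r by (simp add: ennreal_divide_times ennreal_divide_self)
      ultimately show ?thesis using b by (simp add: ennreal_mult)
    qed
    have "emeasure \<mu> (ball x 1) < \<infinity>" for x
      using up[of 1 x] by (auto intro: le_less_trans)
    then have "emeasure \<mu> (ball x r) < \<infinity>" for x r
      using doubling_finite_balls[OF \<mu> D(2), of 1] by simp
    then interpret frac_heat \<mu> D h \<eta> \<alpha> C c1 c2 by (rule kernel)
    have lower: "a * r powr \<beta> \<le> vol x r" and upper: "vol x r \<le> b * r powr \<beta>" if "0 < r" for x r
      using a(2)[OF that, of x] up[OF that, of x] b vol_nonneg[of x r] \<open>\<beta> = \<beta>s\<close>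
      by (simp_all add: emeasure_ball)
    show ?thesis
    proof
      assume "Lp_Lq_bounded \<mu> p \<nu> q ?T"
      then show "?balls c"
        using ball_condition_if_bounded[OF \<nu> pq \<open>0 < \<beta>\<close> \<open>0 < c\<close> b upper] by blast
    next
      assume "?balls c"
      then obtain A where A: "0 < A" "\<And>r t0 x0. 0 < r \<Longrightarrow> 0 < t0 \<Longrightarrow> t0 \<le> c * r powr (2 * \<alpha>) \<Longrightarrow>
          emeasure \<nu> (parabolic_ball \<alpha> r t0 x0) \<le> ennreal (A * r powr (q * \<beta> / p))" by blast
      obtain B where "0 < B" "\<And>K. compact K \<Longrightarrow> K \<subseteq> upper_half \<Longrightarrow>
          emeasure \<nu> K \<le> ennreal (B * measure \<mu> (shadow K) powr (q / p))"
        using shadow_condition_if_ball_condition[OF \<nu> \<open>1 < p\<close> \<open>p < q\<close> \<open>0 < \<beta>\<close> \<open>0 < c\<close> a(1) lower A] by blast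
      then show "Lp_Lq_bounded \<mu> p \<nu> q ?T" by (rule bounded_if_shadow_condition[OF \<nu> pq])
    qed
  qed
  have sup: "(SUP l\<in>{0<..}. ennreal (l powr (p / q)) / capacity_minimizing \<mu> \<eta> h p \<nu> l) < \<infinity> \<longleftrightarrow> ?cap"
    by (subst SUP_divide_finite_iff) auto
  show ?thesis unfolding sup capacity using balls by blast
qed

end
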